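(* Let $n\ge1$ and let $K,K_1,K_2,\dots$ be a sequence of i.i.d. random nonempty compact convex sets in $\mathbb{R}^n$ with $E\|K\|<\infty$. Then the sequence $$E\Big\{\Big|\frac1M\sum_{i=1}^{M}K_i\Big|^{1/n}\Big\},\qquad M=1,2,\dots,$$ is non-decreasing in $M$ and converges to $|EK|^{1/n}$ as $M\to\infty$.
   Context: A random closed set in $\mathbb{R}^n$ is a random element of the space $\mathcal{F}$ of closed subsets of $\mathbb{R}^n$, measurable with respect to the Borel $\sigma$-algebra of the hit-or-miss topology, i.e. the topology generated by the families $\{F\in\mathcal{F}:F\cap C=\emptyset,\ F\cap G_1\ne\emptyset,\dots,F\cap G_m\neq\emptyset\}$ with $C$ compact and $G_1,\dots,G_m$ open. A random compact convex set is a random closed set whose realizations are almost surely compact and convex. $\|K\|=\sup\{\|x\|:x\in K\}$, $|K|$ is Lebesgue measure, and sums and scalar multiples of sets are in the Minkowski sense. The Aumann expectation of a random compact set $K$ is $EK=\{E\xi:\ \xi \text{ is a selector of } K,\ E\xi\text{ exists}\}$, where a selector of $K$ is a random vector $\xi$ in $\mathbb{R}^n$, defined on the same probability space as $K$, with $\xi\in K$ with probability one. For compact convex $K$ with $E\|K\|<\infty$, $EK$ is the compact convex set whose support function is $s_{EK}(u)=E\,s_K(u)$, where $s_A(u)=\sup_{x\in A}\langle u,x\rangle$. *)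

theory Defs
  imports "HOL-Probability.Probability"
begin

text \<open>The hit-or-miss topology on the closed sets. A finite family \<open>H\<close> stands for
  \<open>G\<^sub>1, \<dots>, G\<^sub>m\<close>; the case \<open>m = 0\<close> is included, so that the empty closed set
  also belongs to the space.\<close>

definition hit_or_miss_sets :: "'a::topological_space set set set" where
  "hit_or_miss_sets =
     {{F. closed F \<and> F \<inter> C = {} \<and> (\<forall>G\<in>H. F \<inter> G \<noteq> {})} | C H.
        compact C \<and> finite H \<and> (\<forall>G\<in>H. open G)}"

definition hit_or_miss_topology :: "'a::topological_space set topology" where
  "hit_or_miss_topology = topology_generated_by hit_or_miss_sets"

definition closed_sets_borel :: "'a::topological_space set measure" where
  "closed_sets_borel =
     sigma (topspace hit_or_miss_topology) {U. openin hit_or_miss_topology U}"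

lemma topspace_hit_or_miss_topology:
  "topspace (hit_or_miss_topology :: 'a::topological_space set topology) = {F. closed F}"
proof -
  have "{F :: 'a set. closed F} \<in> hit_or_miss_sets"
    unfolding hit_or_miss_sets_def
    by (rule CollectI, rule exI[of _ "{}"], rule exI[of _ "{}"]) auto
  moreover have "U \<subseteq> {F. closed F}" if "U \<in> hit_or_miss_sets" for U :: "'a set set"
    using that unfolding hit_or_miss_sets_def by auto
  ultimately show ?thesis
    unfolding hit_or_miss_topology_def topology_generated_by_topspace by blast
qed

lemma space_closed_sets_borel:
  "space (closed_sets_borel :: 'a::topological_space set measure) = {F. closed F}"
  by (auto simp: closed_sets_borel_def space_measure_of_conv topspace_hit_or_miss_topology)

definition random_closed_set :: "'w measure \<Rightarrow> ('w \<Rightarrow> 'a::topological_space set) \<Rightarrow> bool" where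
  "random_closed_set P X \<longleftrightarrow> X \<in> P \<rightarrow>\<^sub>M closed_sets_borel"

definition random_compact_convex_set ::
    "'w measure \<Rightarrow> ('w \<Rightarrow> 'a::euclidean_space set) \<Rightarrow> bool" where
  "random_compact_convex_set P X \<longleftrightarrow>
     random_closed_set P X \<and> (AE w in P. compact (X w) \<and> convex (X w))"

text \<open>The supremum is taken in \<open>[0, \<infinity>]\<close>, so that it is meaningful for unbounded sets as well.\<close>

definition set_norm :: "'a::real_normed_vector set \<Rightarrow> ennreal" where
  "set_norm A = (SUP x\<in>A. ennreal (norm x))"

definition selector ::
    "'w measure \<Rightarrow> ('w \<Rightarrow> 'a::euclidean_space set) \<Rightarrow> ('w \<Rightarrow> 'a) \<Rightarrow> bool" where
  "selector P X \<xi> \<longleftrightarrow> \<xi> \<in> borel_measurable P \<and> (AE w in P. \<xi> w \<in> X w)"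

definition aumann_expectation ::
    "'w measure \<Rightarrow> ('w \<Rightarrow> 'a::euclidean_space set) \<Rightarrow> 'a set" where
  "aumann_expectation P X = {integral\<^sup>L P \<xi> | \<xi>. selector P X \<xi> \<and> integrable P \<xi>}"

text \<open>The sum below is the Minkowski sum, i.e. addition of sets as in \<open>Set_Algebras\<close>.\<close>

definition minkowski_mean :: "(nat \<Rightarrow> 'a::real_vector set) \<Rightarrow> nat \<Rightarrow> 'a set" where
  "minkowski_mean A m = (\<lambda>x. (1 / real m) *\<^sub>R x) ` (\<Sum>i=1..m. A i)"

end

theory Submission
  imports Defs
begin

text \<open>Write \<open>V(A) = |A|\<^bsup>1/n\<^esup>\<close> and \<open>S = K\<^sub>1 + \<dots> + K\<^sub>M\<^sub>+\<^sub>1\<close>. For convex summands the \<open>M + 1\<close>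
  leave-one-out sums add up to \<open>M S\<close>, so the Brunn-Minkowski inequality bounds the sum of their
  \<open>V\<close> by \<open>M V(S)\<close>; since they all have the same distribution, taking expectations gives
  monotonicity. The Brunn-Minkowski inequality itself is proved by the box-cutting argument of
  Hadwiger and Ohmann.

  For the limit, compactness of the unit sphere, the Lipschitz continuity of support functions and an
  \<open>L\<^sup>1\<close> law of large numbers for real variables bound the uniform distance \<open>\<epsilon>\<close> between the support
  functions of the Minkowski mean and of \<open>E K\<close> in expectation. The mean lies in the outer parallel set
  of \<open>E K\<close> at distance \<open>\<epsilon>\<close>, and, when \<open>E K\<close> contains a ball of radius \<open>\<rho>\<close>, it contains a translate
  of \<open>(1 - \<epsilon>/\<rho>) E K\<close>; this gives the two bounds on its volume. That the Aumann expectation has the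
  same volume as the body with support function \<open>E s\<^sub>K\<close> follows from selecting the point of \<open>K\<close>
  nearest to \<open>t u\<close> with \<open>t \<rightarrow> \<infinity>\<close>.\<close>

section \<open>The Brunn-Minkowski inequality\<close>

text \<open>The exponent \<open>1/n\<close> makes the functional homogeneous of degree one. It is
  therefore bounded by a constant times the norm of the set, and a first moment of the norm makes it
  integrable although the volume itself may have infinite mean. The same bound shapes the limit:
  where the deviation of the support functions is large, the volume radius grows at most linearly in
  it, so smallness of the deviation in mean is enough and no almost sure convergence is required.
  The lower bound uses a ball inside \<open>E K\<close>. If \<open>E K\<close> has volume zero there
  is none, but then nonnegativity is the whole lower bound. The technical obstacle is measurability:
  the hypotheses speak only of the hit-or-miss sigma-algebra, the values are compact only almost
  surely, and the Minkowski sum of unbounded closed sets need not be closed. Closedness of the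
  Aumann expectation is not established either; its convexity makes the difference from its closure
  a null set.\<close>

definition vol_radius :: "'a::euclidean_space set \<Rightarrow> real" where
  "vol_radius S = measure lebesgue S powr (1 / real DIM('a))"

lemma vol_radius_nonneg: "0 \<le> vol_radius S"
  by (simp add: vol_radius_def)

lemma vol_radius_mono:
  assumes "S \<subseteq> T" "S \<in> sets lebesgue" "T \<in> lmeasurable"
  shows "vol_radius S \<le> vol_radius T"
  unfolding vol_radius_def using assms
  by (intro powr_mono2 measure_mono_fmeasurable) auto

lemma vol_radius_affine:
  fixes S :: "'a::euclidean_space set"
  assumes "0 \<le> c"
  shows "vol_radius ((\<lambda>x. c *\<^sub>R x + a) ` S) = c * vol_radius S"
  unfolding vol_radius_def using assms
  by (simp add: measure_lebesgue_affine powr_mult powr_powr flip: powr_realpow')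

lemma vol_radius_scaleR:
  assumes "0 \<le> c"
  shows "vol_radius ((*\<^sub>R) c ` S) = c * vol_radius S"
  using vol_radius_affine[OF assms, of 0 S] by simp

lemma open_set_plus:
  fixes A B :: "'a::real_normed_vector set"
  assumes "open A" shows "open (A + B)"
proof -
  have "A + B = (\<Union>x\<in>A. \<Union>y\<in>B. {x + y})"
    by (auto simp: set_plus_def)
  then show ?thesis using open_sums[of A B] assms by simp
qed

lemma bounded_set_plus:
  fixes A B :: "'a::real_normed_vector set"
  assumes "bounded A" "bounded B" shows "bounded (A + B)"
proof -
  have "A + B = (\<Union>x\<in>A. \<Union>y\<in>B. {x + y})"
    by (auto simp: set_plus_def)
  then show ?thesis using bounded_sums[of A B] assms by simp
qed

lemma compact_set_plus:
  fixes A B :: "'a::real_normed_vector set"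
  assumes "compact A" "compact B" shows "compact (A + B)"
proof -
  have "A + B = (\<Union>x\<in>A. \<Union>y\<in>B. {x + y})"
    by (auto simp: set_plus_def)
  then show ?thesis using compact_sums'[of A B] assms by simp
qed

section \<open>Brunn-Minkowski for two boxes\<close>

text \<open>The arithmetic-geometric mean inequality is applied to the fractions
  \<open>x i / (x i + y i)\<close> and \<open>y i / (x i + y i)\<close>, whose averages add up to 1.
  With side lengths for \<open>x\<close> and \<open>y\<close> this is the Brunn-Minkowski inequality
  for boxes.\<close>

lemma prod_powr_superadditive:
  fixes x y :: "'i \<Rightarrow> real"
  assumes "finite I" "I \<noteq> {}" "\<And>i. i \<in> I \<Longrightarrow> 0 < x i" "\<And>i. i \<in> I \<Longrightarrow> 0 < y i"
  shows "(\<Prod>i\<in>I. x i) powr (1 / card I) + (\<Prod>i\<in>I. y i) powr (1 / card I)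
    \<le> (\<Prod>i\<in>I. x i + y i) powr (1 / card I)"
proof -
  let ?p = "1 / real (card I)" and ?P = "\<Prod>i\<in>I. x i + y i"
  have P: "0 < ?P" using assms by (intro prod_pos) (auto intro: add_pos_pos)
  have s_pos: "0 < x i + y i" if "i \<in> I" for i
    using assms that by (intro add_pos_pos) auto
  have 1: "(\<Prod>i\<in>I. z i) powr ?p \<le> ?P powr ?p * (\<Sum>i\<in>I. z i / (x i + y i) / card I)"
    if "\<And>i. i \<in> I \<Longrightarrow> 0 < z i" for z
  proof -
    have "(\<Prod>i\<in>I. z i / (x i + y i)) powr ?p \<le> (\<Sum>i\<in>I. z i / (x i + y i) / card I)"
      using assms(1,2) by (intro arith_geom_mean divide_nonneg_pos s_pos less_imp_le[OF that])
    then have "?P powr ?p * (\<Prod>i\<in>I. z i / (x i + y i)) powr ?p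
        \<le> ?P powr ?p * (\<Sum>i\<in>I. z i / (x i + y i) / card I)"
      by (intro mult_left_mono) auto
    moreover have "?P powr ?p * (\<Prod>i\<in>I. z i / (x i + y i)) powr ?p = (\<Prod>i\<in>I. z i) powr ?p"
      using P by (subst powr_mult[symmetric]) (simp add: prod_dividef)
    ultimately show ?thesis by simp
  qed
  have "(\<Sum>i\<in>I. x i / (x i + y i) / card I) + (\<Sum>i\<in>I. y i / (x i + y i) / card I)
      = (\<Sum>i\<in>I. 1 / card I)"
    unfolding sum.distrib[symmetric]
  proof (intro sum.cong refl)
    fix i assume "i \<in> I"
    from s_pos[OF this] show "x i / (x i + y i) / card I + y i / (x i + y i) / card I = 1 / card I"
      by (simp add: add_divide_distrib[symmetric] del: add_divide_distrib)
  qed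
  also have "\<dots> = 1" using assms by simp
  finally have "?P powr ?p * ((\<Sum>i\<in>I. x i / (x i + y i) / card I) + (\<Sum>i\<in>I. y i / (x i + y i) / card I))
      = ?P powr ?p" by simp
  then show ?thesis
    using 1[of x] 1[of y] assms by (simp add: algebra_simps)
qed

lemma box_plus_box_superset:
  fixes a b c d :: "'a::euclidean_space"
  assumes "box a b \<noteq> {}" "box c d \<noteq> {}"
  shows "box (a + c) (b + d) \<subseteq> box a b + box c d"
proof
  fix z assume z: "z \<in> box (a + c) (b + d)"
  have ab: "a \<bullet> i < b \<bullet> i" "c \<bullet> i < d \<bullet> i" if "i \<in> Basis" for i
    using assms that by (auto simp: box_ne_empty)
  \<comment> \<open>In each coordinate the offset of \<open>z\<close> from the lower corner is split
    in the ratio of the two side lengths, which keeps both parts strictly inside their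
    boxes.\<close>
  define x where "x = (\<Sum>i\<in>Basis. (a \<bullet> i + (z \<bullet> i - a \<bullet> i - c \<bullet> i) * ((b \<bullet> i - a \<bullet> i) / (b \<bullet> i - a \<bullet> i + (d \<bullet> i - c \<bullet> i)))) *\<^sub>R i)"
  have x: "x \<bullet> i = a \<bullet> i + (z \<bullet> i - a \<bullet> i - c \<bullet> i) * ((b \<bullet> i - a \<bullet> i) / (b \<bullet> i - a \<bullet> i + (d \<bullet> i - c \<bullet> i)))"
    if "i \<in> Basis" for i
    using that by (simp add: x_def)
  have key: "a \<bullet> i < x \<bullet> i \<and> x \<bullet> i < b \<bullet> i \<and> c \<bullet> i < z \<bullet> i - x \<bullet> i \<and> z \<bullet> i - x \<bullet> i < d \<bullet> i" if i: "i \<in> Basis" for i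
  proof -
    define p q w where "p = b \<bullet> i - a \<bullet> i" "q = d \<bullet> i - c \<bullet> i" "w = z \<bullet> i - a \<bullet> i - c \<bullet> i"
    have pos: "0 < p" "0 < q" "0 < w" "w < p + q"
      using ab[OF i] z i by (auto simp: p_q_w_def mem_box inner_add_left algebra_simps)
    have "0 < w * (p / (p + q))" using pos by simp
    moreover have "w * (p / (p + q)) < p"
      using pos by (simp add: divide_simps)
    moreover have "w - w * (p / (p + q)) = w * (q / (p + q))"
      using pos by (simp add: field_simps)
    moreover have "0 < w * (q / (p + q))" using pos by simp
    moreover have "w * (q / (p + q)) < q"
      using pos by (simp add: divide_simps)
    moreover have "x \<bullet> i = a \<bullet> i + w * (p / (p + q))"
      using x[OF i] by (simp add: p_q_w_def)
    ultimately show ?thesis by (simp add: p_q_w_def)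
  qed
  have "x \<in> box a b" "z - x \<in> box c d"
    using key by (auto simp: mem_box inner_diff_left)
  then show "z \<in> box a b + box c d"
    by (metis add.commute diff_add_cancel set_plus_intro)
qed

lemma brunn_minkowski_boxes:
  fixes a b c d :: "'a::euclidean_space"
  assumes "box a b \<noteq> {}" "box c d \<noteq> {}"
  shows "vol_radius (box a b) + vol_radius (box c d) \<le> vol_radius (box a b + box c d)"
proof -
  have ab: "a \<bullet> i < b \<bullet> i" "c \<bullet> i < d \<bullet> i" if "i \<in> Basis" for i
    using assms that by (auto simp: box_ne_empty)
  have v: "vol_radius (box u v) = (\<Prod>i\<in>Basis. (v - u) \<bullet> i) powr (1 / DIM('a))"
    if "\<And>i. i \<in> Basis \<Longrightarrow> u \<bullet> i < v \<bullet> i" for u v :: 'a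
    using that by (simp add: vol_radius_def measure_lborel_box_eq less_imp_le)
  have "vol_radius (box a b) + vol_radius (box c d) \<le> vol_radius (box (a + c) (b + d))"
    using prod_powr_superadditive[of Basis "\<lambda>i. (b - a) \<bullet> i" "\<lambda>i. (d - c) \<bullet> i"] ab
    by (subst (1 2 3) v) (auto simp: inner_add_left inner_diff_left algebra_simps add_strict_mono)
  also have "\<dots> \<le> vol_radius (box a b + box c d)"
    using box_plus_box_superset[OF assms]
    by (intro vol_radius_mono lmeasurable_open bounded_set_plus open_set_plus) auto
  finally show ?thesis .
qed

section \<open>Hyperplane cuts\<close>

text \<open>Both half-spaces are open, so that an open box is cut into open boxes; what is lost lies
  in the hyperplane, a null set.\<close>

lemma measure_split_hyperplane:
  fixes U :: "'a::euclidean_space set"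
  assumes U: "U \<in> lmeasurable" and i: "i \<in> Basis"
  shows "measure lebesgue (U \<inter> {x. x \<bullet> i < t}) + measure lebesgue (U \<inter> {x. t < x \<bullet> i})
    = measure lebesgue U"
proof -
  have 1: "{x. x \<bullet> i < t} \<in> sets lebesgue" "{x. t < x \<bullet> i} \<in> sets lebesgue"
    by auto
  have "measure lebesgue (U \<inter> {x. x \<bullet> i < t}) + measure lebesgue (U \<inter> {x. t < x \<bullet> i})
      = measure lebesgue ((U \<inter> {x. x \<bullet> i < t}) \<union> (U \<inter> {x. t < x \<bullet> i}))"
  proof -
    have *: "U \<inter> {x. t < x \<bullet> i} - U \<inter> {x. x \<bullet> i < t} = U \<inter> {x. t < x \<bullet> i}" by auto
    have "U \<inter> {x. x \<bullet> i < t} \<in> lmeasurable" "U \<inter> {x. t < x \<bullet> i} \<in> lmeasurable"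
      using U 1 by (auto intro: fmeasurable_Int_fmeasurable)
    then show ?thesis by (simp add: measure_Un2 *)
  qed
  also have "\<dots> = measure lebesgue U"
  proof (rule measure_negligible_symdiff)
    have "negligible {x. x \<bullet> i = t}" using i by (rule negligible_standard_hyperplane)
    then show "negligible (U - (U \<inter> {x. x \<bullet> i < t} \<union> U \<inter> {x. t < x \<bullet> i}) \<union> (U \<inter> {x. x \<bullet> i < t} \<union> U \<inter> {x. t < x \<bullet> i} - U))"
      by (rule negligible_subset) auto
  qed (use U in auto)
  finally show ?thesis .
qed

text \<open>The volume to the left of the hyperplane is the distribution function of the image of
  Lebesgue measure on \<open>U\<close> under the coordinate. Hyperplanes are null, so this measure
  has no atoms, its distribution function is continuous, and the intermediate value theorem
  applies.\<close>

lemma hyperplane_cut_exists: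
  fixes U :: "'a::euclidean_space set"
  assumes U: "open U" "bounded U" and i: "i \<in> Basis"
    and m: "0 \<le> m" "m \<le> measure lebesgue U"
  obtains s where "measure lebesgue (U \<inter> {x. x \<bullet> i < s}) = m"
proof -
  define M where "M = distr (restrict_space lborel U) borel (\<lambda>x. x \<bullet> i)"
  have Ub: "U \<in> sets borel" using U by simp
  have fin: "emeasure lborel U < \<infinity>" using U(2) by (rule emeasure_bounded_finite)
  have meas: "(\<lambda>x. x \<bullet> i) \<in> restrict_space lborel U \<rightarrow>\<^sub>M borel"
    by (intro measurable_restrict_space1) simp
  interpret R: finite_measure "restrict_space lborel U"
    using fin Ub by (intro finite_measureI) (simp add: emeasure_restrict_space space_restrict_space)
  interpret M: finite_borel_measure M
    unfolding M_def by (intro finite_borel_measure.intro R.finite_measure_distr meas) (auto simp: finite_borel_measure_axioms_def)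
  have M_eq: "measure M A = measure lebesgue (U \<inter> {x. x \<bullet> i \<in> A})" if "A \<in> sets borel" for A
  proof -
    have A: "{x. x \<bullet> i \<in> A} \<in> sets borel"
      using that by measurable
    have "measure M A = measure (restrict_space lborel U) ({x. x \<bullet> i \<in> A} \<inter> U)"
      unfolding M_def using that meas
      by (subst measure_distr) (auto simp: space_restrict_space vimage_def Int_def conj_ac)
    also have "\<dots> = measure lborel ({x. x \<bullet> i \<in> A} \<inter> U)"
      using Ub A by (subst measure_restrict_space) auto
    finally show ?thesis
      using Ub A by (simp add: Int_commute)
  qed
  have null: "measure M {s} = 0" for s
  proof -
    have "negligible {x. x \<bullet> i = s}" using i by (rule negligible_standard_hyperplane)
    then have "negligible (U \<inter> {x. x \<bullet> i = s})"
      by (rule negligible_subset) auto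
    then show ?thesis by (simp add: M_eq negligible_imp_measure0)
  qed
  obtain B where B: "\<And>x. x \<in> U \<Longrightarrow> norm x \<le> B"
    using U(2) by (auto simp: bounded_iff)
  \<comment> \<open>The left bound must be strict because the distribution function at a point
    counts the point itself.\<close>
  have xB: "- \<bar>B\<bar> - 1 < x \<bullet> i \<and> x \<bullet> i \<le> \<bar>B\<bar>" if "x \<in> U" for x
    using B[OF that] Basis_le_norm[OF i, of x] by auto
  have lo: "cdf M (- \<bar>B\<bar> - 1) = 0"
  proof -
    have "U \<inter> {x. x \<bullet> i \<in> {..- \<bar>B\<bar> - 1}} = {}" using xB by force
    then show ?thesis by (simp add: cdf_def M_eq)
  qed
  have hi: "cdf M \<bar>B\<bar> = measure lebesgue U"
  proof -
    have "U \<inter> {x. x \<bullet> i \<in> {..\<bar>B\<bar>}} = U" using xB by force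
    then show ?thesis by (simp add: cdf_def M_eq)
  qed
  have "\<exists>s\<ge>- \<bar>B\<bar> - 1. s \<le> \<bar>B\<bar> \<and> cdf M s = m"
    using m null by (intro IVT) (auto simp: lo hi M.isCont_cdf)
  then obtain s where s: "cdf M s = m" by blast
  have "measure M {..s} = measure M {..<s} + measure M {s}"
    unfolding ivl_disj_un(2)[symmetric]
    by (subst M.finite_measure_Union) auto
  then have "measure lebesgue (U \<inter> {x. x \<bullet> i < s}) = m"
    using s null by (simp add: cdf_def M_eq lessThan_def)
  then show thesis by (rule that)
qed

section \<open>Finite families of disjoint open boxes\<close>

text \<open>Openness of the boxes makes the union, and every Minkowski sum with it, open and hence
  measurable. Nonempty members give positive volume, which the ratio of a cut divides by.\<close>

definition box_family :: "'a::euclidean_space set set \<Rightarrow> bool" where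
  "box_family D \<longleftrightarrow> finite D \<and> D \<noteq> {} \<and> disjoint D \<and> (\<forall>X\<in>D. X \<noteq> {} \<and> (\<exists>a b. X = box a b))"

text \<open>Discarding the empty set makes the number of boxes drop as soon as one box misses the
  half-space.\<close>

definition cut_family :: "'a set set \<Rightarrow> 'a set \<Rightarrow> 'a set set" where
  "cut_family D H = (\<lambda>X. X \<inter> H) ` D - {{}}"

lemma Union_cut_family: "\<Union>(cut_family D H) = \<Union>D \<inter> H"
  by (auto simp: cut_family_def)

lemma box_Int_lower_halfspace:
  fixes a b :: "'a::euclidean_space"
  assumes "i \<in> Basis"
  shows "box a b \<inter> {x. x \<bullet> i < t} = box a (\<Sum>j\<in>Basis. (if j = i then min (b \<bullet> i) t else b \<bullet> j) *\<^sub>R j)"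
  using assms by (auto simp: mem_box split: if_splits)

lemma box_Int_upper_halfspace:
  fixes a b :: "'a::euclidean_space"
  assumes "i \<in> Basis"
  shows "box a b \<inter> {x. t < x \<bullet> i} = box (\<Sum>j\<in>Basis. (if j = i then max (a \<bullet> i) t else a \<bullet> j) *\<^sub>R j) b"
  using assms by (auto simp: mem_box split: if_splits)

lemma card_cut_family_le:
  assumes "finite D"
  shows "card (cut_family D H) \<le> card D"
proof -
  have "card (cut_family D H) \<le> card ((\<lambda>X. X \<inter> H) ` D)"
    unfolding cut_family_def using assms by (intro card_mono) auto
  also have "\<dots> \<le> card D" using assms by (rule card_image_le)
  finally show ?thesis .
qed

lemma card_cut_family_less:
  assumes "finite D" "X \<in> D" "X \<inter> H = {}"
  shows "card (cut_family D H) < card D"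
proof -
  have "card (cut_family D H) = card (cut_family (D - {X}) H)"
    using assms by (intro arg_cong[where f=card]) (auto simp: cut_family_def)
  also have "\<dots> \<le> card (D - {X})" using assms by (intro card_cut_family_le) auto
  also have "\<dots> < card D" using assms by (intro card_Diff1_less)
  finally show ?thesis .
qed

lemma box_family_cut:
  fixes D :: "'a::euclidean_space set set"
  assumes D: "box_family D" and i: "i \<in> Basis" and H: "H = {x. x \<bullet> i < t} \<or> H = {x. t < x \<bullet> i}"
    and ne: "\<Union>D \<inter> H \<noteq> {}"
  shows "box_family (cut_family D H)"
  unfolding box_family_def
proof (intro conjI ballI)
  show "finite (cut_family D H)" using D by (auto simp: box_family_def cut_family_def)
  show "cut_family D H \<noteq> {}" using ne by (auto simp: cut_family_def)
  show "disjoint (cut_family D H)"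
    using D by (fastforce simp: box_family_def cut_family_def disjoint_def)
  fix X assume X: "X \<in> cut_family D H"
  then show "X \<noteq> {}" by (simp add: cut_family_def)
  from X obtain X' where X': "X' \<in> D" "X = X' \<inter> H" by (auto simp: cut_family_def)
  moreover obtain a b where "X' = box a b" using D X' unfolding box_family_def by metis
  ultimately have "X = box a b \<inter> H" by simp
  then show "\<exists>a b. X = box a b"
    using H box_Int_lower_halfspace[OF i, of a b t] box_Int_upper_halfspace[OF i, of a b t] by blast
qed

lemma box_family_open: "box_family D \<Longrightarrow> open (\<Union>D)"
  unfolding box_family_def by (metis open_Union open_box)

lemma box_family_bounded: "box_family D \<Longrightarrow> bounded (\<Union>D)"
  unfolding box_family_def by (metis bounded_Union bounded_box)

lemma box_family_lmeasurable: "box_family D \<Longrightarrow> \<Union>D \<in> lmeasurable"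
  by (intro lmeasurable_open box_family_open box_family_bounded)

lemma open_measure_pos:
  fixes U :: "'a::euclidean_space set"
  assumes "open U" "U \<noteq> {}" "U \<in> lmeasurable"
  shows "0 < measure lebesgue U"
proof -
  have "\<not> negligible U" using assms by (simp add: open_not_negligible)
  then have "measure lebesgue U \<noteq> 0" using assms by (simp add: negligible_iff_measure)
  then show ?thesis by (simp add: less_le)
qed

lemma box_family_pos:
  assumes "box_family D" shows "0 < measure lebesgue (\<Union>D)"
  using assms
  by (intro open_measure_pos box_family_open box_family_lmeasurable) (auto simp: box_family_def)

text \<open>Disjoint nonempty boxes have disjoint projections to some coordinate. \<open>X\<close>
  misses the upper side and \<open>Y\<close> the lower one, so each side of the cut retains fewer
  boxes than \<open>D\<close>.\<close>

lemma box_family_separating_hyperplane: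
  fixes D :: "'a::euclidean_space set set"
  assumes D: "box_family D" and card: "2 \<le> card D"
  obtains i t X Y where "i \<in> Basis" "X \<in> D" "Y \<in> D"
    "X \<inter> {x. t < x \<bullet> i} = {}" "Y \<inter> {x. x \<bullet> i < t} = {}"
proof -
  obtain X Y where XY: "X \<in> D" "Y \<in> D" "X \<noteq> Y"
    using card D unfolding box_family_def
    by (metis One_nat_def Suc_1 card_le_Suc0_iff_eq not_less_eq_eq)
  obtain a b c d where ab: "X = box a b" "Y = box c d" "X \<noteq> {}" "Y \<noteq> {}"
    using D XY unfolding box_family_def by metis
  have "X \<inter> Y = {}" using D XY by (auto simp: box_family_def disjoint_def)
  then obtain i where i0: "i \<in> Basis"
    "b \<bullet> i \<le> a \<bullet> i \<or> d \<bullet> i \<le> c \<bullet> i \<or> b \<bullet> i \<le> c \<bullet> i \<or> d \<bullet> i \<le> a \<bullet> i"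
    unfolding ab(1,2) disjoint_interval(4) by blast
  have "a \<bullet> i < b \<bullet> i" "c \<bullet> i < d \<bullet> i"
    using ab i0(1) by (auto simp: box_ne_empty)
  with i0 have i: "i \<in> Basis" "b \<bullet> i \<le> c \<bullet> i \<or> d \<bullet> i \<le> a \<bullet> i"
    by auto
  have *: "box p q \<inter> {x. q \<bullet> i < x \<bullet> i} = {}" "box p q \<inter> {x. x \<bullet> i < p \<bullet> i} = {}" for p q :: 'a
    using i(1) by (auto simp: mem_box intro: less_asym)
  have mono: "{x. x \<bullet> i < t} \<subseteq> {x. x \<bullet> i < s}" if "t \<le> s" for t s
    using that by auto
  from i(2) show thesis
  proof
    assume "b \<bullet> i \<le> c \<bullet> i"
    then have "Y \<inter> {x. x \<bullet> i < b \<bullet> i} = {}"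
      using *(2)[of c d] mono unfolding ab by blast
    then show thesis using *(1)[of a b] XY i(1) by (intro that[of i X Y "b \<bullet> i"]) (auto simp: ab)
  next
    assume "d \<bullet> i \<le> a \<bullet> i"
    then have "X \<inter> {x. x \<bullet> i < d \<bullet> i} = {}"
      using *(2)[of a b] mono unfolding ab by blast
    then show thesis using *(1)[of c d] XY i(1) by (intro that[of i Y X "d \<bullet> i"]) (auto simp: ab)
  qed
qed

text \<open>A hyperplane that separates two boxes of \<open>D\<close>
  splits both unions in the same ratio after \<open>E\<close> is cut by a suitable parallel hyperplane.\<close>

lemma brunn_minkowski_cut_step:
  fixes D E :: "'a::euclidean_space set set"
  assumes D: "box_family D" and E: "box_family E" and card: "2 \<le> card D"
    and IH: "\<And>D' E'. \<lbrakk>box_family D'; box_family E'; card D' + card E' < card D + card E\<rbrakk>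
      \<Longrightarrow> vol_radius (\<Union>D' :: 'a set) + vol_radius (\<Union>E') \<le> vol_radius (\<Union>D' + \<Union>E')"
  shows "vol_radius (\<Union>D) + vol_radius (\<Union>E) \<le> vol_radius (\<Union>D + \<Union>E)"
proof -
  obtain i t X Y where i: "i \<in> Basis" and X: "X \<in> D" "X \<inter> {x. t < x \<bullet> i} = {}"
    and Y: "Y \<in> D" "Y \<inter> {x. x \<bullet> i < t} = {}"
    using box_family_separating_hyperplane[OF D card] by metis
  define p where "p = 1 / real DIM('a)"
  have p: "0 < p" by (simp add: p_def)
  define A where "A = \<Union>D"
  define B where "B = \<Union>E"
  define vA where "vA = measure lebesgue A"
  define vB where "vB = measure lebesgue B"
  have vA: "0 < vA" and vB: "0 < vB"
    using box_family_pos[OF D] box_family_pos[OF E] by (simp_all add: vA_def vB_def A_def B_def)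
  have lm: "A \<in> lmeasurable" "B \<in> lmeasurable"
    using D E by (simp_all add: A_def B_def box_family_lmeasurable)
  have opn: "open A" "open B" "bounded A" "bounded B"
    using D E by (simp_all add: A_def B_def box_family_open box_family_bounded)
  have half: "{x. x \<bullet> i < s} \<in> sets lebesgue" "{x. s < x \<bullet> i} \<in> sets lebesgue" for s by auto
  have Xin: "X \<subseteq> A" "Y \<subseteq> A" "open X" "open Y" "X \<noteq> {}" "Y \<noteq> {}"
  proof -
    have "open Z \<and> Z \<noteq> {}" if "Z \<in> D" for Z
      using D that unfolding box_family_def by (metis open_box)
    then show "open X" "open Y" "X \<noteq> {}" "Y \<noteq> {}" using X(1) Y(1) by blast+
    show "X \<subseteq> A" "Y \<subseteq> A" using X(1) Y(1) unfolding A_def by blast+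
  qed
  have nonemp: "A \<inter> {x. x \<bullet> i < t} \<noteq> {}" "A \<inter> {x. t < x \<bullet> i} \<noteq> {}"
  proof -
    \<comment> \<open>A nonempty open set is not negligible and cannot lie in the hyperplane; hence
      \<open>X\<close>, which misses the upper side, meets the lower one, and \<open>Y\<close>
      conversely.\<close>
    have *: "\<not> Z \<subseteq> {x. x \<bullet> i = t}" if "open Z" "Z \<noteq> {}" for Z
      using negligible_subset[OF negligible_standard_hyperplane[OF i, of t]] open_not_negligible[OF that] by blast
    show "A \<inter> {x. x \<bullet> i < t} \<noteq> {}" using *[of X] Xin X(2) by force
    show "A \<inter> {x. t < x \<bullet> i} \<noteq> {}" using *[of Y] Xin Y(2) by force
  qed
  define Dl where "Dl = cut_family D {x. x \<bullet> i < t}"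
  define Dr where "Dr = cut_family D {x. t < x \<bullet> i}"
  have Dl: "box_family Dl" "card Dl < card D" "\<Union>Dl = A \<inter> {x. x \<bullet> i < t}"
  proof -
    show "\<Union>Dl = A \<inter> {x. x \<bullet> i < t}" by (simp add: Dl_def A_def Union_cut_family)
    show "box_family Dl" unfolding Dl_def using nonemp(1) by (intro box_family_cut[OF D i]) (auto simp: A_def)
    show "card Dl < card D" unfolding Dl_def using D by (intro card_cut_family_less[OF _ Y]) (simp add: box_family_def)
  qed
  have Dr: "box_family Dr" "card Dr < card D" "\<Union>Dr = A \<inter> {x. t < x \<bullet> i}"
  proof -
    show "\<Union>Dr = A \<inter> {x. t < x \<bullet> i}" by (simp add: Dr_def A_def Union_cut_family)
    show "box_family Dr" unfolding Dr_def using nonemp(2) by (intro box_family_cut[OF D i]) (auto simp: A_def)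
    show "card Dr < card D" unfolding Dr_def using D by (intro card_cut_family_less[OF _ X]) (simp add: box_family_def)
  qed
  define \<theta> where "\<theta> = measure lebesgue (\<Union>Dl) / vA"
  have split_A: "measure lebesgue (\<Union>Dl) + measure lebesgue (\<Union>Dr) = vA"
    unfolding Dl Dr vA_def using lm(1) i by (rule measure_split_hyperplane)
  have posD: "0 < measure lebesgue (\<Union>Dl)" "0 < measure lebesgue (\<Union>Dr)"
    by (rule box_family_pos, fact)+
  have \<theta>: "0 < \<theta>" "\<theta> < 1"
    using posD split_A vA by (simp_all add: \<theta>_def)
  have Al: "measure lebesgue (\<Union>Dl) = \<theta> * vA" and Ar: "measure lebesgue (\<Union>Dr) = (1 - \<theta>) * vA"
  proof -
    show *: "measure lebesgue (\<Union>Dl) = \<theta> * vA" using vA by (simp add: \<theta>_def)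
    show "measure lebesgue (\<Union>Dr) = (1 - \<theta>) * vA" using split_A by (simp add: * algebra_simps)
  qed
  obtain s where s: "measure lebesgue (B \<inter> {x. x \<bullet> i < s}) = \<theta> * vB"
    using hyperplane_cut_exists[OF opn(2,4) i, of "\<theta> * vB"] \<theta> vB by (auto simp: vB_def)
  define El where "El = cut_family E {x. x \<bullet> i < s}"
  define Er where "Er = cut_family E {x. s < x \<bullet> i}"
  have El_eq: "\<Union>El = B \<inter> {x. x \<bullet> i < s}" and Er_eq: "\<Union>Er = B \<inter> {x. s < x \<bullet> i}"
    by (auto simp: El_def Er_def B_def Union_cut_family)
  have Bl: "measure lebesgue (\<Union>El) = \<theta> * vB" using s by (simp add: El_eq)
  have Br: "measure lebesgue (\<Union>Er) = (1 - \<theta>) * vB"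
    using measure_split_hyperplane[OF lm(2) i, of s] s by (simp add: Er_eq vB_def algebra_simps)
  have nonempE: "\<Union>El \<noteq> {}" "\<Union>Er \<noteq> {}"
  proof -
    have "0 < measure lebesgue (\<Union>El)" "0 < measure lebesgue (\<Union>Er)"
      unfolding Bl Br using \<theta> vB by simp_all
    moreover have "U \<noteq> {}" if "0 < measure lebesgue U" for U :: "'a set"
      using that by auto
    ultimately show "\<Union>El \<noteq> {}" "\<Union>Er \<noteq> {}" by blast+
  qed
  have El: "box_family El" "card El \<le> card E"
  proof -
    show "box_family El"
      unfolding El_def using nonempE(1) El_eq by (intro box_family_cut[OF E i]) (auto simp: B_def)
    show "card El \<le> card E"
      unfolding El_def using E by (intro card_cut_family_le) (simp add: box_family_def)
  qed
  have Er: "box_family Er" "card Er \<le> card E"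
  proof -
    show "box_family Er"
      unfolding Er_def using nonempE(2) Er_eq by (intro box_family_cut[OF E i]) (auto simp: B_def)
    show "card Er \<le> card E"
      unfolding Er_def using E by (intro card_cut_family_le) (simp add: box_family_def)
  qed
  \<comment> \<open>\<open>f\<close> is the volume that the inequality predicts for
    \<open>A + B\<close>. It is homogeneous of degree one in the two volumes, so pieces that take
    the same share \<open>q\<close> of both have predicted volume \<open>q * f\<close>, and the two
    predictions add up to \<open>f\<close>.\<close>
  define f where "f = (vA powr p + vB powr p) powr (1 / p)"
  have scaled: "q * f \<le> measure lebesgue (\<Union>D' + \<Union>E')"
    if "box_family D'" "box_family E'" "card D' + card E' < card D + card E"
      "measure lebesgue (\<Union>D') = q * vA" "measure lebesgue (\<Union>E') = q * vB" "0 < q" for D' E' :: "'a set set" and q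
  proof -
    have "(q * vA) powr p + (q * vB) powr p \<le> measure lebesgue (\<Union>D' + \<Union>E') powr p"
      using IH[OF that(1-3)] that(4,5) by (simp add: vol_radius_def p_def)
    then have "q powr p * (vA powr p + vB powr p) \<le> measure lebesgue (\<Union>D' + \<Union>E') powr p"
      using that(6) vA vB by (simp add: powr_mult algebra_simps)
    then have "(q powr p * (vA powr p + vB powr p)) powr (1 / p) \<le> (measure lebesgue (\<Union>D' + \<Union>E') powr p) powr (1 / p)"
      using p by (intro powr_mono2) auto
    then show ?thesis
      using p that(6) by (simp add: powr_mult powr_powr f_def)
  qed
  have l: "\<theta> * f \<le> measure lebesgue (\<Union>Dl + \<Union>El)"
    using Dl El Al Bl \<theta> by (intro scaled) auto
  have r: "(1 - \<theta>) * f \<le> measure lebesgue (\<Union>Dr + \<Union>Er)"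
    using Dr Er Ar Br \<theta> by (intro scaled) auto
  have lmS: "\<Union>Dl + \<Union>El \<in> lmeasurable" "\<Union>Dr + \<Union>Er \<in> lmeasurable" "A + B \<in> lmeasurable"
    by (intro lmeasurable_open bounded_set_plus open_set_plus box_family_open box_family_bounded
        Dl(1) Dr(1) El(1) Er(1) opn)+
  \<comment> \<open>The hyperplane at height \<open>t + s\<close> separates the sum of the lower
    parts from the sum of the upper parts, so their volumes add.\<close>
  have disj: "(\<Union>Dl + \<Union>El) \<inter> (\<Union>Dr + \<Union>Er) = {}"
  proof -
    have "z \<bullet> i < t + s" if "z \<in> \<Union>Dl + \<Union>El" for z
      using that unfolding Dl El_eq by (auto simp: set_plus_def inner_add_left)
    moreover have "t + s < z \<bullet> i" if "z \<in> \<Union>Dr + \<Union>Er" for z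
      using that unfolding Dr Er_eq by (auto simp: set_plus_def inner_add_left)
    ultimately show ?thesis by fastforce
  qed
  have "f = \<theta> * f + (1 - \<theta>) * f" by (simp add: algebra_simps)
  also have "\<dots> \<le> measure lebesgue (\<Union>Dl + \<Union>El) + measure lebesgue (\<Union>Dr + \<Union>Er)"
    using l r by simp
  also have "\<dots> = measure lebesgue ((\<Union>Dl + \<Union>El) \<union> (\<Union>Dr + \<Union>Er))"
    using lmS disj by (subst measure_Un2) (auto simp: Diff_triv Int_commute)
  also have "\<dots> \<le> measure lebesgue (A + B)"
  proof (rule measure_mono_fmeasurable)
    show "(\<Union>Dl + \<Union>El) \<union> (\<Union>Dr + \<Union>Er) \<subseteq> A + B"
      unfolding Dl Dr El_eq Er_eq by (auto simp: set_plus_def)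
  qed (use lmS in auto)
  finally have "f powr p \<le> measure lebesgue (A + B) powr p"
    using p by (intro powr_mono2) (auto simp: f_def)
  moreover have "f powr p = vA powr p + vB powr p"
    using p by (simp add: f_def powr_powr)
  ultimately show ?thesis
    by (simp add: vol_radius_def A_def B_def vA_def vB_def p_def)
qed

text \<open>Induction on the total number of boxes: a cut strictly lowers the count on the side of
  the family with two or more members and does not raise the other count. Commutativity of the sum
  lets either family play that part.\<close>

lemma brunn_minkowski_box_families:
  fixes D E :: "'a::euclidean_space set set"
  assumes "box_family D" "box_family E"
  shows "vol_radius (\<Union>D) + vol_radius (\<Union>E) \<le> vol_radius (\<Union>D + \<Union>E)"
  using assms
proof (induction "card D + card E" arbitrary: D E rule: less_induct)
  case less
  have pos: "0 < card D" "0 < card E"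
    using less.prems by (auto simp: box_family_def card_gt_0_iff)
  consider "2 \<le> card D" | "2 \<le> card E" | "card D = 1" "card E = 1"
    using pos by linarith
  then show ?case
  proof cases
    case 1
    show ?thesis
    proof (rule brunn_minkowski_cut_step[OF less.prems 1])
      fix D' E' :: "'a set set"
      assume "box_family D'" "box_family E'" "card D' + card E' < card D + card E"
      then show "vol_radius (\<Union>D') + vol_radius (\<Union>E') \<le> vol_radius (\<Union>D' + \<Union>E')"
        by (intro less.hyps)
    qed
  next
    case 2
    have "vol_radius (\<Union>E) + vol_radius (\<Union>D) \<le> vol_radius (\<Union>E + \<Union>D)"
    proof (rule brunn_minkowski_cut_step[OF less.prems(2,1) 2])
      fix D' E' :: "'a set set"
      assume "box_family D'" "box_family E'" "card D' + card E' < card E + card D"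
      then show "vol_radius (\<Union>D') + vol_radius (\<Union>E') \<le> vol_radius (\<Union>D' + \<Union>E')"
        by (intro less.hyps) simp_all
    qed
    then show ?thesis by (simp add: add.commute)
  next
    case 3
    then obtain X Y where XY: "D = {X}" "E = {Y}" by (metis card_1_singletonE)
    have X: "X \<noteq> {}" "\<exists>a b. X = box a b" and Y: "Y \<noteq> {}" "\<exists>a b. Y = box a b"
      using less.prems by (simp_all add: XY box_family_def)
    then obtain a b c d where "X = box a b" "Y = box c d" by blast
    with X Y show ?thesis using brunn_minkowski_boxes[of a b c d] by (simp add: XY)
  qed
qed

section \<open>From box families to compact sets\<close>

text \<open>Cover \<open>A\<close> by countably many non-overlapping cells, each inside a ball of
  radius \<open>\<delta>\<close> about a point of \<open>A\<close>. Their boundaries are null, so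
  finitely many of the interiors already carry the volume of \<open>A\<close> up to
  \<open>\<eta>\<close>. The resulting boxes need not lie in \<open>A\<close>, only near it.\<close>

lemma compact_box_family_approx:
  fixes A :: "'a::euclidean_space set"
  assumes A: "compact A" "A \<noteq> {}" and pos: "0 < \<delta>" "0 < \<eta>"
  obtains D where "box_family D" "\<Union>D \<subseteq> A + cball 0 \<delta>" "measure lebesgue A - \<eta> \<le> measure lebesgue (\<Union>D)"
proof -
  obtain c where c: "A \<subseteq> cbox (- c) c"
    using bounded_subset_cbox_symmetric[OF compact_imp_bounded[OF A(1)]] by metis
  \<comment> \<open>The margin \<open>One\<close> makes the open box nonempty even when
    \<open>c\<close> has zero coordinates, as for a single point at the origin.\<close>
  have sub: "A \<subseteq> cbox (- c - One) (c + One)"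
    using c by (fastforce simp: mem_box inner_diff_left inner_add_left)
  have cge: "0 \<le> c \<bullet> i" if "i \<in> Basis" for i
    using c A(2) that by (force simp: mem_box)
  have ne: "box (- c - One) (c + One) \<noteq> {}"
  proof -
    have "- (c \<bullet> i) - 1 < c \<bullet> i + 1" if "i \<in> Basis" for i using cge[OF that] by simp
    then show ?thesis by (simp add: box_ne_empty inner_diff_left inner_add_left)
  qed
  have gauge: "gauge (\<lambda>x. ball x \<delta>)" using pos by (simp add: gauge_def)
  obtain \<D> where D: "countable \<D>" "\<Union>\<D> \<subseteq> cbox (- c - One) (c + One)"
    "\<And>K. K \<in> \<D> \<Longrightarrow> interior K \<noteq> {} \<and> (\<exists>c d. K = cbox c d)"
    "pairwise (\<lambda>A B. interior A \<inter> interior B = {}) \<D>"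
    "\<And>K. K \<in> \<D> \<Longrightarrow> \<exists>x \<in> A \<inter> K. K \<subseteq> ball x \<delta>"
    "A \<subseteq> \<Union>\<D>"
    using covering_lemma[OF sub ne gauge] by metis
  have D_ne: "\<D> \<noteq> {}" using D(6) A(2) by auto
  define F where "F k = (\<Union>j\<le>k. interior (from_nat_into \<D> j))" for k
  have UF: "(\<Union>k. F k) = \<Union>(interior ` \<D>)"
  proof -
    have "(\<Union>k. F k) = \<Union>(interior ` range (from_nat_into \<D>))"
      by (auto simp: F_def)
    then show ?thesis using D(1) D_ne by (simp add: range_from_nat_into)
  qed
  have Fopen: "open (F k)" for k by (auto simp: F_def)
  have UFsub: "(\<Union>k. F k) \<subseteq> cbox (- c - One) (c + One)"
    unfolding UF using D(2) interior_subset by fastforce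
  have UFlm: "(\<Union>k. F k) \<in> lmeasurable"
    using Fopen by (intro lmeasurable_open bounded_subset[OF bounded_cbox UFsub]) auto
  have Flm: "F k \<in> lmeasurable" for k
    using Fopen UFsub by (intro lmeasurable_open bounded_subset[OF bounded_cbox]) auto
  have "measure lebesgue A \<le> measure lebesgue (\<Union>k. F k)"
  proof -
    let ?N = "\<Union>K\<in>\<D>. K - interior K"
    have N: "negligible ?N"
    proof (rule negligible_countable_Union[OF countable_image[OF D(1)]])
      fix X assume "X \<in> (\<lambda>K. K - interior K) ` \<D>"
      then obtain K where K: "K \<in> \<D>" "X = K - interior K" by auto
      then obtain u v where "K = cbox u v" using D(3) by blast
      then show "negligible X"
        using negligible_convex_frontier[of K] K by (simp add: frontier_def)
    qed
    have Us: "(\<Union>k. F k) \<union> ?N \<in> lmeasurable"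
      using UFlm N by (intro fmeasurable.Un) (auto simp: negligible_iff_measure)
    have "measure lebesgue A \<le> measure lebesgue ((\<Union>k. F k) \<union> ?N)"
      using D(6) A Us by (intro measure_mono_fmeasurable) (auto simp: UF lmeasurable_compact fmeasurableD)
    also have "\<dots> = measure lebesgue (\<Union>k. F k)"
      using UFlm N by (intro measure_Un_null_set) (auto simp: negligible_iff_null_sets)
    finally show ?thesis .
  qed
  moreover have "(\<lambda>k. measure lebesgue (F k)) \<longlonglongrightarrow> measure lebesgue (\<Union>k. F k)"
  proof (rule Lim_measure_incseq)
    show "range F \<subseteq> sets lebesgue" using Flm by (auto intro: fmeasurableD)
    show "incseq F" unfolding incseq_def F_def by (intro allI impI UN_mono) auto
    show "emeasure lebesgue (\<Union>k. F k) \<noteq> \<infinity>"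
      unfolding infinity_ennreal_def by (rule fmeasurableD2[OF UFlm])
  qed
  ultimately have "\<forall>\<^sub>F k in sequentially. measure lebesgue A - \<eta> < measure lebesgue (F k)"
    using pos(2) by (intro order_tendstoD(1)) auto
  then obtain k where k: "measure lebesgue A - \<eta> < measure lebesgue (F k)"
    by (auto simp: eventually_sequentially)
  define E where "E = (\<lambda>j. interior (from_nat_into \<D> j)) ` {..k}"
  have inD: "from_nat_into \<D> j \<in> \<D>" for j using D_ne by (rule from_nat_into)
  have "box_family E"
    unfolding box_family_def
  proof (intro conjI ballI)
    show "disjoint E"
    \<comment> \<open>The enumeration may list a cell more than once, so distinctness is taken from
      the interiors back to the cells and not from the indices.\<close>
    proof (rule disjointI)
      fix X Y assume "X \<in> E" "Y \<in> E" "X \<noteq> Y"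
      then obtain j l where jl: "X = interior (from_nat_into \<D> j)" "Y = interior (from_nat_into \<D> l)"
        by (auto simp: E_def)
      with \<open>X \<noteq> Y\<close> have "from_nat_into \<D> j \<noteq> from_nat_into \<D> l" by auto
      from pairwiseD[OF D(4) inD inD this] show "X \<inter> Y = {}" by (simp add: jl)
    qed
    fix X assume "X \<in> E"
    then obtain K where K: "K \<in> \<D>" "X = interior K" using inD by (auto simp: E_def)
    moreover obtain u v where "K = cbox u v" using D(3)[OF K(1)] by blast
    ultimately have "X = box u v" by (simp add: interior_cbox)
    then show "\<exists>a b. X = box a b" by blast
    show "X \<noteq> {}" using D(3)[OF K(1)] K(2) by simp
  qed (auto simp: E_def)
  moreover have "\<Union>E \<subseteq> A + cball 0 \<delta>"
  proof
    fix y assume "y \<in> \<Union>E"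
    then obtain K where K: "K \<in> \<D>" "y \<in> K" using inD interior_subset by (fastforce simp: E_def)
    then obtain x where x: "x \<in> A" "K \<subseteq> ball x \<delta>" using D(5) by blast
    then have "y - x \<in> cball 0 \<delta>" using K by (auto simp: dist_norm norm_minus_commute subset_iff)
    then show "y \<in> A + cball 0 \<delta>" using x(1) by (metis add.commute diff_add_cancel set_plus_intro)
  qed
  moreover have "\<Union>E = F k" by (auto simp: E_def F_def)
  ultimately show thesis using k by (intro that[of E]) auto
qed

text \<open>The parallel bodies decrease, and a point at distance zero from a closed set belongs to
  it; so their intersection is \<open>C\<close>, and continuity from above applies.\<close>

lemma measure_parallel_body_tendsto:
  fixes C :: "'a::euclidean_space set"
  assumes C: "compact C" "C \<noteq> {}"
  shows "(\<lambda>k. measure lebesgue (C + cball 0 (1 / real (Suc k)))) \<longlonglongrightarrow> measure lebesgue C"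
proof -
  let ?W = "\<lambda>k. C + cball 0 (1 / real (Suc k)) :: 'a set"
  have W: "compact (?W k)" for k using C by (intro compact_set_plus) auto
  have "(\<lambda>k. measure lebesgue (?W k)) \<longlonglongrightarrow> measure lebesgue (\<Inter>k. ?W k)"
  proof (rule Lim_measure_decseq)
    show "range ?W \<subseteq> sets lebesgue" using W by (auto intro!: fmeasurableD lmeasurable_compact)
    show "decseq ?W"
    proof (rule decseq_SucI)
      fix k
      have "cball (0::'a) (1 / real (Suc (Suc k))) \<subseteq> cball 0 (1 / real (Suc k))"
        by (intro subset_cball) (simp add: divide_simps)
      then show "?W (Suc k) \<subseteq> ?W k" by (rule set_plus_mono2[OF subset_refl])
    qed
    show "emeasure lebesgue (?W k) \<noteq> \<infinity>" for k
      unfolding infinity_ennreal_def by (rule fmeasurableD2[OF lmeasurable_compact[OF W]])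
  qed
  moreover have "(\<Inter>k. ?W k) = C"
  proof
    show "C \<subseteq> (\<Inter>k. ?W k)"
    proof
      fix x assume "x \<in> C"
      then have "x + 0 \<in> ?W k" for k by (intro set_plus_intro) auto
      then show "x \<in> (\<Inter>k. ?W k)" by simp
    qed
    show "(\<Inter>k. ?W k) \<subseteq> C"
    proof
      fix x assume x: "x \<in> (\<Inter>k. ?W k)"
      have le: "infdist x C \<le> 1 / real (Suc k)" for k
      proof -
        from x obtain c v where "c \<in> C" "norm v \<le> 1 / real (Suc k)" "x = c + v"
          by (force simp: set_plus_def)
        then show ?thesis
          by (intro order_trans[OF infdist_le[of c C x]]) (auto simp: dist_norm)
      qed
      have "infdist x C \<le> 0"
        using le by (intro LIMSEQ_le_const[OF LIMSEQ_inverse_real_of_nat]) (auto simp: inverse_eq_divide)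
      then have "infdist x C = 0" using infdist_nonneg[of x C] by simp
      then show "x \<in> C" using C by (simp add: in_closed_iff_infdist_zero compact_imp_closed)
    qed
  qed
  ultimately show ?thesis by simp
qed

text \<open>Box families within distance \<open>\<epsilon> k / 2\<close> of \<open>A\<close> and of
  \<open>B\<close> have their Minkowski sum inside the parallel body of \<open>A + B\<close> at
  distance \<open>\<epsilon> k\<close>. The inequality for boxes passes to the limit because the
  volumes of these parallel bodies converge.\<close>

theorem brunn_minkowski:
  fixes A B :: "'a::euclidean_space set"
  assumes A: "compact A" "A \<noteq> {}" and B: "compact B" "B \<noteq> {}"
  shows "vol_radius A + vol_radius B \<le> vol_radius (A + B)"
proof -
  define p where "p = 1 / real DIM('a)"
  have p: "0 < p" by (simp add: p_def)
  define \<epsilon> where "\<epsilon> k = 1 / real (Suc k)" for k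
  have \<epsilon>: "0 < \<epsilon> k" for k by (simp add: \<epsilon>_def)
  have \<epsilon>0: "\<epsilon> \<longlonglongrightarrow> 0"
    unfolding \<epsilon>_def using LIMSEQ_inverse_real_of_nat by (simp add: inverse_eq_divide)
  \<comment> \<open>The approximate volume may be negative; cutting it at 0 keeps the base of
    \<open>powr\<close> in the range where the power is monotone.\<close>
  let ?a = "\<lambda>S k. max 0 (measure lebesgue S - \<epsilon> k)"
  have AB: "compact (A + B)" "A + B \<noteq> {}"
    using compact_set_plus[OF A(1) B(1)] A B by (auto simp: set_plus_def)
  have key: "?a A k powr p + ?a B k powr p \<le> measure lebesgue ((A + B) + cball 0 (\<epsilon> k)) powr p" for k
  proof -
    have e2: "0 < \<epsilon> k / 2" using \<epsilon>[of k] by simp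
    obtain D where D: "box_family D" "\<Union>D \<subseteq> A + cball 0 (\<epsilon> k / 2)"
      "measure lebesgue A - \<epsilon> k \<le> measure lebesgue (\<Union>D)"
      using compact_box_family_approx[OF A e2 \<epsilon>] by metis
    obtain E where E: "box_family E" "\<Union>E \<subseteq> B + cball 0 (\<epsilon> k / 2)"
      "measure lebesgue B - \<epsilon> k \<le> measure lebesgue (\<Union>E)"
      using compact_box_family_approx[OF B e2 \<epsilon>] by metis
    have "?a A k powr p + ?a B k powr p \<le> vol_radius (\<Union>D) + vol_radius (\<Union>E)"
      unfolding vol_radius_def p_def[symmetric] using D(3) E(3) p
      by (intro add_mono powr_mono2) auto
    also have "\<dots> \<le> vol_radius (\<Union>D + \<Union>E)"
      by (rule brunn_minkowski_box_families[OF D(1) E(1)])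
    also have "\<dots> \<le> vol_radius ((A + B) + cball 0 (\<epsilon> k))"
    proof (rule vol_radius_mono)
      have cc: "cball 0 (\<epsilon> k / 2) + cball (0::'a) (\<epsilon> k / 2) \<subseteq> cball 0 (\<epsilon> k)"
      proof
        fix z assume "z \<in> cball 0 (\<epsilon> k / 2) + cball (0::'a) (\<epsilon> k / 2)"
        then obtain x y :: 'a where "z = x + y" "norm x \<le> \<epsilon> k / 2" "norm y \<le> \<epsilon> k / 2"
          by (auto simp: set_plus_def)
        then show "z \<in> cball 0 (\<epsilon> k)" using norm_triangle_ineq[of x y] by simp
      qed
      have "\<Union>D + \<Union>E \<subseteq> (A + cball 0 (\<epsilon> k / 2)) + (B + cball 0 (\<epsilon> k / 2))"
        using D(2) E(2) by (rule set_plus_mono2)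
      also have "\<dots> = (A + B) + (cball 0 (\<epsilon> k / 2) + cball 0 (\<epsilon> k / 2))"
        by (simp add: ac_simps)
      also have "\<dots> \<subseteq> (A + B) + cball 0 (\<epsilon> k)"
        using cc by (rule set_plus_mono2[OF subset_refl])
      finally show "\<Union>D + \<Union>E \<subseteq> (A + B) + cball 0 (\<epsilon> k)" .
      show "\<Union>D + \<Union>E \<in> sets lebesgue"
        using D E by (intro fmeasurableD lmeasurable_open open_set_plus bounded_set_plus box_family_open box_family_bounded)
      show "(A + B) + cball 0 (\<epsilon> k) \<in> lmeasurable"
        using AB(1) by (rule lmeasurable_compact[OF compact_set_plus[OF _ compact_cball]])
    qed
    finally show ?thesis by (simp add: vol_radius_def p_def)
  qed
  have lim_a: "(\<lambda>k. ?a S k powr p) \<longlonglongrightarrow> measure lebesgue S powr p" for S :: "'a set"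
  proof (rule tendsto_powr')
    show "?a S \<longlonglongrightarrow> measure lebesgue S"
      by (rule tendsto_eq_rhs[OF tendsto_max[OF tendsto_const tendsto_diff[OF tendsto_const \<epsilon>0]]]) simp
  qed (use p in auto)
  have "(\<lambda>k. measure lebesgue ((A + B) + cball 0 (\<epsilon> k)) powr p) \<longlonglongrightarrow> measure lebesgue (A + B) powr p"
    using measure_parallel_body_tendsto[OF AB] p unfolding \<epsilon>_def by (intro tendsto_powr') auto
  with tendsto_add[OF lim_a[of A] lim_a[of B]]
  have "measure lebesgue A powr p + measure lebesgue B powr p \<le> measure lebesgue (A + B) powr p"
    using key by (intro LIMSEQ_le[where X = "\<lambda>k. ?a A k powr p + ?a B k powr p"]) auto
  then show ?thesis by (simp add: vol_radius_def p_def)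
qed

lemma sum_set_nonempty:
  assumes "\<And>i. i \<in> I \<Longrightarrow> A i \<noteq> {}"
  shows "(\<Sum>i\<in>I. A i) \<noteq> {}"
  using assms by (induction I rule: infinite_finite_induct) (auto simp: set_plus_def)

lemma compact_sum_set:
  fixes A :: "'i \<Rightarrow> 'a::real_normed_vector set"
  assumes "\<And>i. i \<in> I \<Longrightarrow> compact (A i)"
  shows "compact (\<Sum>i\<in>I. A i)"
  using assms by (induction I rule: infinite_finite_induct) (auto simp: compact_set_plus)

lemma brunn_minkowski_sum:
  fixes A :: "'i \<Rightarrow> 'a::euclidean_space set"
  assumes "\<And>i. i \<in> I \<Longrightarrow> compact (A i)" "\<And>i. i \<in> I \<Longrightarrow> A i \<noteq> {}"
  shows "(\<Sum>i\<in>I. vol_radius (A i)) \<le> vol_radius (\<Sum>i\<in>I. A i)"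
  using assms
proof (induction I rule: infinite_finite_induct)
  case (insert i I)
  have "(\<Sum>i\<in>insert i I. vol_radius (A i)) \<le> vol_radius (A i) + vol_radius (\<Sum>i\<in>I. A i)"
    using insert by simp
  also have "\<dots> \<le> vol_radius (A i + (\<Sum>i\<in>I. A i))"
    using insert.prems by (intro brunn_minkowski compact_sum_set sum_set_nonempty) auto
  finally show ?case using insert by simp
qed (auto simp: vol_radius_nonneg)

section \<open>Measurability of the volume of a Minkowski sum\<close>

lemma sets_closed_sets_borel_basic:
  assumes "compact C" "finite H" "\<And>G. G \<in> H \<Longrightarrow> open G"
  shows "{F. closed F \<and> F \<inter> C = {} \<and> (\<forall>G\<in>H. F \<inter> G \<noteq> {})} \<in> sets closed_sets_borel"
proof -
  have "openin hit_or_miss_topology {F. closed F \<and> F \<inter> C = {} \<and> (\<forall>G\<in>H. F \<inter> G \<noteq> {})}"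
    unfolding hit_or_miss_topology_def hit_or_miss_sets_def using assms
    by (intro topology_generated_by_Basis) auto
  moreover have "{U. openin hit_or_miss_topology U} \<subseteq> Pow (topspace hit_or_miss_topology)"
    using openin_subset by auto
  ultimately show ?thesis
    unfolding closed_sets_borel_def by (subst sets_measure_of) (auto intro: sigma_sets.Basic)
qed

lemma sets_closed_sets_borel_hit_open:
  assumes "open G"
  shows "{F. closed F \<and> F \<inter> G \<noteq> {}} \<in> sets closed_sets_borel"
  using sets_closed_sets_borel_basic[of "{}" "{G}"] assms by simp

lemma sets_closed_sets_borel_hit_compact:
  assumes "compact C"
  shows "{F. closed F \<and> F \<inter> C \<noteq> {}} \<in> sets closed_sets_borel"
proof -
  have "space closed_sets_borel - {F. closed F \<and> F \<inter> C = {}} \<in> sets closed_sets_borel"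
    using sets_closed_sets_borel_basic[of C "{}"] assms by (intro sets.compl_sets) auto
  moreover have "space closed_sets_borel - {F. closed F \<and> F \<inter> C = {}} = {F. closed F \<and> F \<inter> C \<noteq> {}}"
    by (auto simp: space_closed_sets_borel)
  ultimately show ?thesis by simp
qed

text \<open>Hitting events of compact sets are all that the volume needs. Unlike measurability into
  \<open>closed_sets_borel\<close>, this form is easily carried through truncations and Minkowski
  sums.\<close>

definition hits_compacts_measurably :: "'w measure \<Rightarrow> ('w \<Rightarrow> 'a::topological_space set) \<Rightarrow> bool" where
  "hits_compacts_measurably M X \<longleftrightarrow> (\<forall>C. compact C \<longrightarrow> {w \<in> space M. X w \<inter> C \<noteq> {}} \<in> sets M)"

lemma hits_compacts_measurablyD:
  "hits_compacts_measurably M X \<Longrightarrow> compact C \<Longrightarrow> {w \<in> space M. X w \<inter> C \<noteq> {}} \<in> sets M"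
  by (simp add: hits_compacts_measurably_def)

lemma closed_of_measurable_closed_sets_borel:
  "X \<in> M \<rightarrow>\<^sub>M closed_sets_borel \<Longrightarrow> w \<in> space M \<Longrightarrow> closed (X w)"
  by (drule measurable_space) (auto simp: space_closed_sets_borel)

lemma hits_compacts_measurably_closed_sets:
  fixes X :: "'w \<Rightarrow> 'a::topological_space set"
  assumes "X \<in> M \<rightarrow>\<^sub>M closed_sets_borel"
  shows "hits_compacts_measurably M X"
  unfolding hits_compacts_measurably_def
proof (intro allI impI)
  fix C :: "'a set" assume "compact C"
  then have "X -` {F. closed F \<and> F \<inter> C \<noteq> {}} \<inter> space M \<in> sets M"
    by (rule measurable_sets[OF assms sets_closed_sets_borel_hit_compact])
  moreover have "X -` {F. closed F \<and> F \<inter> C \<noteq> {}} \<inter> space M = {w \<in> space M. X w \<inter> C \<noteq> {}}"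
    using closed_of_measurable_closed_sets_borel[OF assms] by auto
  ultimately show "{w \<in> space M. X w \<inter> C \<noteq> {}} \<in> sets M" by simp
qed

lemma hits_compacts_measurably_Int:
  fixes X :: "'w \<Rightarrow> 'a::t2_space set"
  assumes "hits_compacts_measurably M X" "compact B"
  shows "hits_compacts_measurably M (\<lambda>w. X w \<inter> B)"
  unfolding hits_compacts_measurably_def
  using hits_compacts_measurablyD[OF assms(1) compact_Int[OF assms(2)]] by (simp add: Int_assoc)

text \<open>The sum hits \<open>C\<close> exactly when, at every scale, there are points
  \<open>p\<close>, \<open>q\<close> of a countable dense set such that \<open>p + q\<close> is
  close to \<open>C\<close> and small balls about \<open>p\<close> and \<open>q\<close> are hit by
  \<open>X\<close> and \<open>Y\<close>. These are countably many events. Conversely, approximation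
  at every scale puts the compact sum at distance zero from \<open>C\<close>, which forces an
  intersection.\<close>

lemma hits_compacts_measurably_plus:
  fixes X Y :: "'w \<Rightarrow> 'a::euclidean_space set"
  assumes X: "hits_compacts_measurably M X" "\<And>w. w \<in> space M \<Longrightarrow> compact (X w)"
    and Y: "hits_compacts_measurably M Y" "\<And>w. w \<in> space M \<Longrightarrow> compact (Y w)"
  shows "hits_compacts_measurably M (\<lambda>w. X w + Y w)"
  unfolding hits_compacts_measurably_def
proof (intro allI impI)
  fix C :: "'a set" assume C: "compact C"
  obtain D :: "'a set" where D: "countable D" "\<And>U. open U \<Longrightarrow> U \<noteq> {} \<Longrightarrow> \<exists>d\<in>D. d \<in> U"
    using countable_dense_exists[where 'a='a] by blast
  let ?e = "\<lambda>k. 1 / real (Suc k)"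
  let ?Q = "\<lambda>k. {q \<in> D \<times> D. \<exists>c\<in>C. dist (fst q + snd q) c \<le> 2 * ?e k}"
  have near: "\<exists>d\<in>D. dist x d \<le> ?e k" for x k
    using D(2)[of "ball x (?e k)"] by (auto intro: less_imp_le)
  have iff: "(X w + Y w) \<inter> C \<noteq> {} \<longleftrightarrow> (\<forall>k. \<exists>q\<in>?Q k. X w \<inter> cball (fst q) (?e k) \<noteq> {} \<and> Y w \<inter> cball (snd q) (?e k) \<noteq> {})"
    (is "?L \<longleftrightarrow> ?R") if w: "w \<in> space M" for w
  proof
    assume ?L
    then obtain x y where xy: "x \<in> X w" "y \<in> Y w" "x + y \<in> C" by (auto simp: set_plus_def)
    show ?R
    proof
      fix k
      obtain p q where pq: "p \<in> D" "q \<in> D" "dist x p \<le> ?e k" "dist y q \<le> ?e k"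
        using near by metis
      have "dist (p + q) (x + y) \<le> 2 * ?e k"
        using dist_triangle_add[of p q x y] pq(3,4) by (simp add: dist_commute)
      then show "\<exists>q\<in>?Q k. X w \<inter> cball (fst q) (?e k) \<noteq> {} \<and> Y w \<inter> cball (snd q) (?e k) \<noteq> {}"
      proof (intro bexI[of _ "(p, q)"] conjI)
        have "x \<in> X w \<inter> cball p (?e k)" using xy pq by (simp add: dist_commute)
        then show "X w \<inter> cball (fst (p, q)) (?e k) \<noteq> {}" by auto
        have "y \<in> Y w \<inter> cball q (?e k)" using xy pq by (simp add: dist_commute)
        then show "Y w \<inter> cball (snd (p, q)) (?e k) \<noteq> {}" by auto
      qed (use xy pq in auto)
    qed
  next
    assume R: ?R
    have comp: "compact (X w + Y w)" using X(2) Y(2) w by (intro compact_set_plus) auto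
    have *: "(X w + Y w) \<noteq> {} \<and> C \<noteq> {} \<and> setdist (X w + Y w) C \<le> 4 * ?e k" for k
    proof -
      obtain p q c x y where "c \<in> C" "dist (p + q) c \<le> 2 * ?e k" "x \<in> X w" "dist p x \<le> ?e k"
        "y \<in> Y w" "dist q y \<le> ?e k"
        using R[rule_format, of k] by fastforce
      \<comment> \<open>Two radii separate \<open>x + y\<close> from \<open>p + q\<close>, and two
        more separate \<open>p + q\<close> from \<open>c\<close>.\<close>
      moreover from this have "dist (x + y) c \<le> 4 * ?e k"
        using dist_triangle[of "x + y" c "p + q"] dist_triangle_add[of x y p q] by (simp add: dist_commute)
      moreover have "setdist (X w + Y w) C \<le> dist (x + y) c"
        using calculation by (intro setdist_le_dist) auto
      ultimately show ?thesis by (auto simp: set_plus_def)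
    qed
    have "(\<lambda>k. 4 * ?e k) \<longlonglongrightarrow> 4 * 0"
      using LIMSEQ_inverse_real_of_nat by (intro tendsto_mult tendsto_const) (simp add: inverse_eq_divide)
    then have "setdist (X w + Y w) C \<le> 4 * 0"
      by (rule LIMSEQ_le_const) (use * in blast)
    then have "setdist (X w + Y w) C = 0" using setdist_pos_le[of "X w + Y w" C] by simp
    then show ?L
      using setdist_eq_0_compact_closed[OF comp compact_imp_closed[OF C]] * by blast
  qed
  have "{w \<in> space M. (X w + Y w) \<inter> C \<noteq> {}} = {w \<in> space M. \<forall>k. \<exists>q\<in>?Q k.
      w \<in> {w \<in> space M. X w \<inter> cball (fst q) (?e k) \<noteq> {}} \<inter> {w \<in> space M. Y w \<inter> cball (snd q) (?e k) \<noteq> {}}}"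
  proof (intro Collect_cong conj_cong refl)
    fix w assume w: "w \<in> space M"
    show "(X w + Y w) \<inter> C \<noteq> {} \<longleftrightarrow> (\<forall>k. \<exists>q\<in>?Q k.
      w \<in> {w \<in> space M. X w \<inter> cball (fst q) (?e k) \<noteq> {}} \<inter> {w \<in> space M. Y w \<inter> cball (snd q) (?e k) \<noteq> {}})"
      unfolding iff[OF w] using w by simp
  qed
  also have "\<dots> \<in> sets M"
  proof (intro sets.sets_Collect_countable_All sets.sets_Collect_countable_Ex')
    show "countable (?Q k)" for k
      using D(1) by (intro countable_Collect countable_SIGMA) auto
    show "{w \<in> space M. w \<in> {w \<in> space M. X w \<inter> cball (fst q) (?e k) \<noteq> {}} \<inter> {w \<in> space M. Y w \<inter> cball (snd q) (?e k) \<noteq> {}}} \<in> sets M" for q k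
      using hits_compacts_measurablyD[OF X(1) compact_cball[of "fst q" "?e k"]]
        hits_compacts_measurablyD[OF Y(1) compact_cball[of "snd q" "?e k"]]
      by (simp add: Collect_conj_eq[symmetric] sets.Int sets.sets_Collect_conj)
  qed
  finally show "{w \<in> space M. (X w + Y w) \<inter> C \<noteq> {}} \<in> sets M" .
qed

lemma hits_compacts_measurably_sum:
  fixes X :: "'i \<Rightarrow> 'w \<Rightarrow> 'a::euclidean_space set"
  assumes "\<And>i. i \<in> I \<Longrightarrow> hits_compacts_measurably M (X i)"
    and "\<And>i w. i \<in> I \<Longrightarrow> w \<in> space M \<Longrightarrow> compact (X i w)"
  shows "hits_compacts_measurably M (\<lambda>w. \<Sum>i\<in>I. X i w)"
  using assms
proof (induction I rule: infinite_finite_induct)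
  case (insert i I)
  then show ?case
    by (simp, intro hits_compacts_measurably_plus compact_sum_set) auto
qed (auto simp: hits_compacts_measurably_def)

text \<open>Membership of \<open>x\<close> in the closed value is tested through balls about a
  countable dense set that contain \<open>x\<close> and are hit at every scale; the graph thus
  becomes a countable combination of measurable rectangles.\<close>

lemma hits_compacts_measurably_graph:
  fixes X :: "'w \<Rightarrow> 'a::euclidean_space set"
  assumes X: "hits_compacts_measurably M X" "\<And>w. w \<in> space M \<Longrightarrow> closed (X w)"
  shows "{z \<in> space (M \<Otimes>\<^sub>M borel). snd z \<in> X (fst z)} \<in> sets (M \<Otimes>\<^sub>M borel)"
proof -
  obtain D :: "'a set" where D: "countable D" "\<And>U. open U \<Longrightarrow> U \<noteq> {} \<Longrightarrow> \<exists>d\<in>D. d \<in> U"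
    using countable_dense_exists[where 'a='a] by blast
  let ?e = "\<lambda>k. 1 / real (Suc k)"
  let ?S = "\<lambda>q k. {w \<in> space M. X w \<inter> cball q (?e k) \<noteq> {}} \<times> cball q (?e k)"
  have iff: "x \<in> X w \<longleftrightarrow> (\<forall>k. \<exists>q\<in>D. (w, x) \<in> ?S q k)" if w: "w \<in> space M" for w x
  proof
    assume x: "x \<in> X w"
    show "\<forall>k. \<exists>q\<in>D. (w, x) \<in> ?S q k"
    proof
      fix k
      obtain q where "q \<in> D" "q \<in> ball x (?e k)" using D(2)[of "ball x (?e k)"] by auto
      then show "\<exists>q\<in>D. (w, x) \<in> ?S q k" using x w by (force simp: dist_commute less_imp_le)
    qed
  next
    assume R: "\<forall>k. \<exists>q\<in>D. (w, x) \<in> ?S q k"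
    have *: "X w \<noteq> {} \<and> infdist x (X w) \<le> 2 * ?e k" for k
    proof -
      obtain q y where "dist q x \<le> ?e k" "y \<in> X w" "dist q y \<le> ?e k"
        using R[rule_format, of k] by auto
      moreover from this have "dist x y \<le> 2 * ?e k"
        using dist_triangle[of x y q] by (simp add: dist_commute)
      ultimately show ?thesis using infdist_le2[of y "X w" x] by blast
    qed
    have "(\<lambda>k. 2 * ?e k) \<longlonglongrightarrow> 2 * 0"
      using LIMSEQ_inverse_real_of_nat by (intro tendsto_mult tendsto_const) (simp add: inverse_eq_divide)
    then have "infdist x (X w) \<le> 2 * 0"
      by (rule LIMSEQ_le_const) (use * in blast)
    then have "infdist x (X w) = 0" using infdist_nonneg[of x "X w"] by simp
    then show "x \<in> X w" using in_closed_iff_infdist_zero[OF X(2)[OF w]] * by blast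
  qed
  have "{z \<in> space (M \<Otimes>\<^sub>M borel). snd z \<in> X (fst z)}
      = {z \<in> space (M \<Otimes>\<^sub>M borel). \<forall>k. \<exists>q\<in>D. z \<in> ?S q k}"
    using iff by (auto simp: space_pair_measure)
  also have "\<dots> \<in> sets (M \<Otimes>\<^sub>M borel)"
  proof (intro sets.sets_Collect_countable_All sets.sets_Collect_countable_Ex' D)
    fix k q
    have "?S q k \<in> sets (M \<Otimes>\<^sub>M borel)"
      using hits_compacts_measurablyD[OF X(1)] by (intro pair_measureI) auto
    then show "{z \<in> space (M \<Otimes>\<^sub>M borel). z \<in> ?S q k} \<in> sets (M \<Otimes>\<^sub>M borel)"
      using sets.Int[OF _ sets.top] by (simp add: Collect_conj_eq Int_commute)
  qed
  finally show ?thesis .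
qed

text \<open>The value at \<open>w\<close> is the section of the graph over \<open>w\<close>, and the
  measure of a section of a product-measurable set is measurable in \<open>w\<close>.\<close>

lemma measurable_emeasure_random_set:
  fixes X :: "'w \<Rightarrow> 'a::euclidean_space set"
  assumes X: "hits_compacts_measurably M X" "\<And>w. w \<in> space M \<Longrightarrow> closed (X w)"
  shows "(\<lambda>w. emeasure lborel (X w)) \<in> borel_measurable M"
proof -
  let ?G = "{z \<in> space (M \<Otimes>\<^sub>M borel). snd z \<in> X (fst z)}"
  have "?G \<in> sets (M \<Otimes>\<^sub>M lborel)"
    using hits_compacts_measurably_graph[OF X] by (simp cong: sets_pair_measure_cong)
  then have "(\<lambda>w. emeasure lborel (Pair w -` ?G)) \<in> borel_measurable M"
    by (rule lborel.measurable_emeasure_Pair)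
  moreover have "Pair w -` ?G = X w" if "w \<in> space M" for w
    using that by (auto simp: space_pair_measure)
  ultimately show ?thesis by (simp cong: measurable_cong)
qed

section \<open>Minkowski sums of unbounded closed sets\<close>

text \<open>A single representation as a sum has finitely many summands, so one ball contains them
  all. Closed values are thereby reduced to compact ones, to which the hitting argument
  applies.\<close>

lemma Minkowski_sum_truncation:
  fixes F :: "'i \<Rightarrow> 'a::real_normed_vector set"
  shows "(\<Sum>i\<in>I. F i) = (\<Union>N. \<Sum>i\<in>I. F i \<inter> cball 0 (real N))"
    and "incseq (\<lambda>N. \<Sum>i\<in>I. F i \<inter> cball 0 (real N))"
proof -
  have mono: "(\<Sum>i\<in>I. A i) \<subseteq> (\<Sum>i\<in>I. B i)" if "\<And>i. A i \<subseteq> B i" for A B :: "'i \<Rightarrow> 'a set"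
    using that by (induction I rule: infinite_finite_induct) (simp_all add: set_plus_mono2)
  show "incseq (\<lambda>N. \<Sum>i\<in>I. F i \<inter> cball 0 (real N))"
  proof (rule incseq_SucI)
    show "(\<Sum>i\<in>I. F i \<inter> cball 0 (real N)) \<subseteq> (\<Sum>i\<in>I. F i \<inter> cball 0 (real (Suc N)))" for N
      by (intro mono) auto
  qed
  show "(\<Sum>i\<in>I. F i) = (\<Union>N. \<Sum>i\<in>I. F i \<inter> cball 0 (real N))"
  proof
    show "(\<Union>N. \<Sum>i\<in>I. F i \<inter> cball 0 (real N)) \<subseteq> (\<Sum>i\<in>I. F i)"
      by (intro UN_least mono) auto
    show "(\<Sum>i\<in>I. F i) \<subseteq> (\<Union>N. \<Sum>i\<in>I. F i \<inter> cball 0 (real N))"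
    \<comment> \<open>Over an infinite index set both sums are \<open>{0}\<close> by
      convention.\<close>
    proof (cases "finite I")
      case True
      show ?thesis
      proof
        fix x assume "x \<in> (\<Sum>i\<in>I. F i)"
        then obtain s where s: "x = sum s I" "\<forall>i\<in>I. s i \<in> F i"
          using True by (auto simp: set_sum_alt)
        obtain N :: nat where "(\<Sum>i\<in>I. norm (s i)) \<le> real N" using real_arch_simple by blast
        moreover have "norm (s i) \<le> (\<Sum>i\<in>I. norm (s i))" if "i \<in> I" for i
          using True that by (intro member_le_sum) auto
        ultimately have "\<forall>i\<in>I. s i \<in> F i \<inter> cball 0 (real N)"
          using s(2) by (auto intro: order_trans)
        then show "x \<in> (\<Union>N. \<Sum>i\<in>I. F i \<inter> cball 0 (real N))"
          using s(1) True by (auto simp: set_sum_alt)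
      qed
    qed auto
  qed
qed

text \<open>A Minkowski sum of closed sets need not be closed, but the truncations exhibit it as a
  countable union of compact sets.\<close>

lemma borel_Minkowski_sum:
  fixes F :: "'i \<Rightarrow> 'a::euclidean_space set"
  assumes "\<And>i. i \<in> I \<Longrightarrow> closed (F i)"
  shows "(\<Sum>i\<in>I. F i) \<in> sets borel"
  unfolding Minkowski_sum_truncation(1)[of F I] using assms
  by (intro sets.countable_UN) (auto intro!: borel_compact compact_sum_set closed_Int_compact)

text \<open>On a null set the values may be unbounded, and the underlying measure need not be complete; the
  truncations by balls make the sum measurable there as well.\<close>

lemma measurable_measure_Minkowski_sum:
  fixes X :: "'i \<Rightarrow> 'w \<Rightarrow> 'a::euclidean_space set"
  assumes X: "\<And>i. i \<in> I \<Longrightarrow> X i \<in> M \<rightarrow>\<^sub>M closed_sets_borel"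
  shows "(\<lambda>w. measure lebesgue (\<Sum>i\<in>I. X i w)) \<in> borel_measurable M"
proof -
  let ?T = "\<lambda>N w. \<Sum>i\<in>I. X i w \<inter> cball 0 (real N)"
  have cl: "closed (X i w)" if "i \<in> I" "w \<in> space M" for i w
    using closed_of_measurable_closed_sets_borel[OF X] that by blast
  have comp: "compact (?T N w)" if "w \<in> space M" for N w
    using cl that by (intro compact_sum_set closed_Int_compact) auto
  have "(\<lambda>w. emeasure lborel (?T N w)) \<in> borel_measurable M" for N
    using cl comp
    by (intro measurable_emeasure_random_set hits_compacts_measurably_sum hits_compacts_measurably_Int
        hits_compacts_measurably_closed_sets X) (auto intro: compact_imp_closed closed_Int_compact)
  then have "(\<lambda>w. SUP N. emeasure lborel (?T N w)) \<in> borel_measurable M"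
    by (intro borel_measurable_SUP) auto
  then have "(\<lambda>w. enn2real (SUP N. emeasure lborel (?T N w))) \<in> borel_measurable M"
    by measurable
  moreover have "enn2real (SUP N. emeasure lborel (?T N w)) = measure lebesgue (\<Sum>i\<in>I. X i w)"
    if w: "w \<in> space M" for w
  proof -
    have "(SUP N. emeasure lborel (?T N w)) = emeasure lborel (\<Union>N. ?T N w)"
      using comp[OF w] Minkowski_sum_truncation(2)
      by (intro SUP_emeasure_incseq) (auto intro: borel_compact)
    also have "(\<Union>N. ?T N w) = (\<Sum>i\<in>I. X i w)"
      by (rule Minkowski_sum_truncation(1)[symmetric])
    finally show ?thesis
      using borel_Minkowski_sum[OF cl[OF _ w], of I] by (simp add: measure_def)
  qed
  ultimately show ?thesis by (simp cong: measurable_cong)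
qed

section \<open>A law of large numbers in mean\<close>

lemma integrable_distr_cong:
  fixes f :: "'b \<Rightarrow> real"
  assumes "X \<in> M \<rightarrow>\<^sub>M N" "Y \<in> M \<rightarrow>\<^sub>M N" "distr M N X = distr M N Y" "f \<in> borel_measurable N"
  shows "integrable M (\<lambda>w. f (X w)) \<longleftrightarrow> integrable M (\<lambda>w. f (Y w))"
    and "integral\<^sup>L M (\<lambda>w. f (X w)) = integral\<^sup>L M (\<lambda>w. f (Y w))"
  using integrable_distr_eq[of X M N f] integrable_distr_eq[of Y M N f]
    integral_distr[of X M N f] integral_distr[of Y M N f] assms by simp_all

text \<open>Independence makes the product of a new centred summand with the earlier sum integrate
  to zero, so second moments add.\<close>

lemma (in prob_space) second_moment_sum_le:
  fixes Z :: "'i \<Rightarrow> 'a \<Rightarrow> real" and c :: real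
  assumes "finite I" "indep_vars (\<lambda>_. borel) Z I"
    and "\<And>i w. i \<in> I \<Longrightarrow> \<bar>Z i w\<bar> \<le> c" "\<And>i. i \<in> I \<Longrightarrow> expectation (Z i) = 0"
  shows "integrable M (\<lambda>w. (\<Sum>i\<in>I. Z i w)\<^sup>2) \<and> expectation (\<lambda>w. (\<Sum>i\<in>I. Z i w)\<^sup>2) \<le> card I * c\<^sup>2"
  using assms
proof (induction I rule: finite_induct)
  case (insert i I)
  define S where "S w = (\<Sum>j\<in>I. Z j w)" for w
  have IH: "integrable M (\<lambda>w. (S w)\<^sup>2)" "expectation (\<lambda>w. (S w)\<^sup>2) \<le> card I * c\<^sup>2"
    using insert indep_vars_subset[OF insert.prems(1)] by (auto simp: S_def)
  have rv: "Z j \<in> borel_measurable M" if "j \<in> insert i I" for j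
    using insert.prems(1) that by (auto simp: indep_vars_def)
  have intZ: "integrable M (Z j)" if "j \<in> insert i I" for j
    using insert.prems(2) rv that by (intro integrable_const_bound[where B = c]) auto
  have intS: "integrable M S" unfolding S_def using intZ by auto
  have Z2: "(Z i w)\<^sup>2 \<le> c\<^sup>2" for w
    using insert.prems(2)[of i w] by (simp add: abs_le_square_iff[symmetric])
  have intZ2: "integrable M (\<lambda>w. (Z i w)\<^sup>2)"
    using Z2 rv[of i] by (intro integrable_const_bound[where B = "c\<^sup>2"]) auto
  have indep: "indep_var borel (Z i) borel S"
    unfolding S_def using insert by (intro indep_vars_sum) auto
  have cross: "integrable M (\<lambda>w. Z i w * S w)" "expectation (\<lambda>w. Z i w * S w) = 0"
    using indep_var_integrable[OF indep intZ intS] indep_var_lebesgue_integral[OF indep intZ intS]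
      insert.prems(3)[of i] by simp_all
  have sq: "(\<Sum>j\<in>insert i I. Z j w)\<^sup>2 = (Z i w)\<^sup>2 + 2 * (Z i w * S w) + (S w)\<^sup>2" for w
    using insert by (simp add: S_def power2_sum algebra_simps)
  have "expectation (\<lambda>w. (Z i w)\<^sup>2) \<le> c\<^sup>2"
    using integral_mono[OF intZ2 integrable_const Z2] by (simp add: prob_space)
  then show ?case
    unfolding sq using intZ2 cross IH insert.hyps by (simp add: distrib_right)
qed simp

text \<open>Truncation at level \<open>c\<close> leaves a tail whose mean \<open>t c\<close> is the
  same for every index, while the centred truncated variables are bounded and their average tends to
  zero in mean square. The level is fixed before \<open>m\<close> grows, so a first moment
  suffices.\<close>

theorem (in prob_space) L1_law_of_large_numbers:
  fixes X :: "nat \<Rightarrow> 'a \<Rightarrow> real"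
  assumes indep: "indep_vars (\<lambda>_. borel) X UNIV"
    and ident: "\<And>i. distr M borel (X i) = distr M borel (X 0)"
    and int0: "integrable M (X 0)"
  shows "(\<lambda>m. expectation (\<lambda>w. \<bar>(\<Sum>i=1..m. X i w) / real m - expectation (X 0)\<bar>)) \<longlonglongrightarrow> 0"
proof -
  define \<mu> where "\<mu> = expectation (X 0)"
  have rv: "X i \<in> borel_measurable M" for i
    using indep by (simp add: indep_vars_def)
  have transfer: "integrable M (\<lambda>w. f (X i w)) \<longleftrightarrow> integrable M (\<lambda>w. f (X 0 w))"
    "expectation (\<lambda>w. f (X i w)) = expectation (\<lambda>w. f (X 0 w))"
    if "f \<in> borel_measurable borel" for f :: "real \<Rightarrow> real" and i
    using integrable_distr_cong[OF rv rv ident that] by simp_all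
  define g where "g c x = (if \<bar>x\<bar> \<le> c then x else 0)" for c x :: real
  have g_meas: "g c \<in> borel_measurable borel" for c unfolding g_def by measurable
  have g_bound: "\<bar>g c x\<bar> \<le> \<bar>c\<bar>" "\<bar>x - g c x\<bar> \<le> \<bar>x\<bar>" for c x by (auto simp: g_def)
  have intg: "integrable M (\<lambda>w. g c (X i w))" for c i
    using g_bound(1) measurable_compose[OF rv g_meas] by (intro integrable_const_bound[where B = "\<bar>c\<bar>"]) auto
  have intX: "integrable M (X i)" for i
    using transfer(1)[of "\<lambda>x. x" i] int0 by simp
  define t where "t c = expectation (\<lambda>w. \<bar>X 0 w - g c (X 0 w)\<bar>)" for c
  have t_lim: "(\<lambda>k. t (real k)) \<longlonglongrightarrow> expectation (\<lambda>w. 0)"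
    unfolding t_def
  proof (rule integral_dominated_convergence)
    show "integrable M (\<lambda>w. \<bar>X 0 w\<bar>)" using int0 by simp
    show "AE w in M. (\<lambda>k. \<bar>X 0 w - g (real k) (X 0 w)\<bar>) \<longlonglongrightarrow> 0"
    proof (rule AE_I2)
      fix w
      obtain N :: nat where N: "\<bar>X 0 w\<bar> \<le> real N" using real_arch_simple by blast
      have "\<forall>\<^sub>F k in sequentially. \<bar>X 0 w - g (real k) (X 0 w)\<bar> = 0"
        using eventually_ge_at_top[of N] by eventually_elim (use N in \<open>auto simp: g_def\<close>)
      then show "(\<lambda>k. \<bar>X 0 w - g (real k) (X 0 w)\<bar>) \<longlonglongrightarrow> 0"
        by (rule tendsto_eventually)
    qed
  qed (use g_bound rv g_meas in \<open>auto intro!: borel_measurable_abs borel_measurable_diff measurable_compose[OF rv g_meas]\<close>)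
  \<comment> \<open>One \<open>t c\<close> pays for the average of the tails, the other for the
    change of the mean under truncation. The remaining terms come from
    \<open>v \<le> \<eta> / 2 + v^2 / (2 * \<eta>)\<close>, which turns a second moment into a first
    moment.\<close>
  have est: "expectation (\<lambda>w. \<bar>(\<Sum>i=1..m. X i w) / real m - \<mu>\<bar>) \<le> 2 * t c + \<eta> / 2 + (2 * \<bar>c\<bar>)\<^sup>2 / (2 * \<eta> * real m)"
    if m: "1 \<le> m" and \<eta>: "0 < \<eta>" for m c \<eta>
  proof -
    define \<nu> where "\<nu> = expectation (\<lambda>w. g c (X 0 w))"
    define Z where "Z i w = g c (X i w) - \<nu>" for i w
    define W where "W w = (\<Sum>i=1..m. Z i w)" for w
    have \<nu>: "\<bar>\<nu>\<bar> \<le> \<bar>c\<bar>"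
    proof -
      have "\<bar>\<nu>\<bar> \<le> expectation (\<lambda>w. \<bar>g c (X 0 w)\<bar>)" unfolding \<nu>_def by (rule integral_abs_bound)
      also have "\<dots> \<le> expectation (\<lambda>w. \<bar>c\<bar>)"
        using intg g_bound(1) by (intro integral_mono) auto
      finally show ?thesis by (simp add: prob_space)
    qed
    have "indep_vars (\<lambda>_. borel) Z {1..m}"
      unfolding Z_def using g_meas
      by (intro indep_vars_compose2[where Y = "\<lambda>_ x. g c x - \<nu>", OF indep_vars_subset[OF indep]]) auto
    moreover have "\<bar>Z i w\<bar> \<le> 2 * \<bar>c\<bar>" for i w
      using g_bound(1)[of c "X i w"] \<nu> unfolding Z_def by linarith
    moreover have "expectation (Z i) = 0" for i
      unfolding Z_def using intg transfer(2)[OF g_meas, of c i] by (simp add: \<nu>_def prob_space)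
    ultimately have W2: "integrable M (\<lambda>w. (W w)\<^sup>2)" "expectation (\<lambda>w. (W w)\<^sup>2) \<le> m * (2 * \<bar>c\<bar>)\<^sup>2"
      using second_moment_sum_le[where I = "{1..m}" and Z = Z and c = "2 * \<bar>c\<bar>"] by (auto simp: W_def)
    have \<nu>\<mu>: "\<bar>\<nu> - \<mu>\<bar> \<le> t c"
    proof -
      have "\<nu> - \<mu> = expectation (\<lambda>w. g c (X 0 w) - X 0 w)"
        unfolding \<nu>_def \<mu>_def using intg int0 by (simp add: Bochner_Integration.integral_diff)
      also have "\<bar>\<dots>\<bar> \<le> expectation (\<lambda>w. \<bar>g c (X 0 w) - X 0 w\<bar>)" by (rule integral_abs_bound)
      finally show ?thesis by (simp add: t_def abs_minus_commute)
    qed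
    have tX: "integrable M (\<lambda>w. \<bar>X i w - g c (X i w)\<bar>)" "expectation (\<lambda>w. \<bar>X i w - g c (X i w)\<bar>) = t c" for i
      using intX intg transfer(2)[of "\<lambda>x. \<bar>x - g c x\<bar>" i] g_meas by (simp_all add: t_def)
    have pw: "\<bar>(\<Sum>i=1..m. X i w) / real m - \<mu>\<bar>
        \<le> (\<Sum>i=1..m. \<bar>X i w - g c (X i w)\<bar>) / real m + (\<eta> / 2 + (W w)\<^sup>2 / (2 * \<eta> * (real m)\<^sup>2)) + t c" for w
    proof -
      have "(\<Sum>i=1..m. X i w) = (\<Sum>i=1..m. X i w - g c (X i w)) + W w + real m * \<nu>"
        by (simp add: W_def Z_def sum_subtractf)
      then have "(\<Sum>i=1..m. X i w) / real m - \<mu>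
          = (\<Sum>i=1..m. X i w - g c (X i w)) / real m + W w / real m + (\<nu> - \<mu>)"
        using m by (simp add: field_simps)
      then have "\<bar>(\<Sum>i=1..m. X i w) / real m - \<mu>\<bar>
          \<le> \<bar>(\<Sum>i=1..m. X i w - g c (X i w)) / real m\<bar> + \<bar>W w / real m\<bar> + \<bar>\<nu> - \<mu>\<bar>"
        by linarith
      moreover have "\<bar>(\<Sum>i=1..m. X i w - g c (X i w)) / real m\<bar> \<le> (\<Sum>i=1..m. \<bar>X i w - g c (X i w)\<bar>) / real m"
        by (simp add: divide_right_mono)
      moreover have "\<bar>W w / real m\<bar> \<le> \<eta> / 2 + (W w)\<^sup>2 / (2 * \<eta> * (real m)\<^sup>2)"
      proof -
        define v where "v = \<bar>W w / real m\<bar>"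
        have "0 \<le> (v - \<eta>)\<^sup>2" by simp
        then have "2 * \<eta> * v \<le> \<eta>\<^sup>2 + v\<^sup>2" by (simp add: power2_diff algebra_simps)
        then have "v \<le> \<eta> / 2 + v\<^sup>2 / (2 * \<eta>)" using \<eta> by (simp add: field_simps power2_eq_square)
        then show ?thesis by (simp add: v_def power_divide mult.commute)
      qed
      ultimately show ?thesis using \<nu>\<mu> by linarith
    qed
    have "expectation (\<lambda>w. \<bar>(\<Sum>i=1..m. X i w) / real m - \<mu>\<bar>)
        \<le> expectation (\<lambda>w. (\<Sum>i=1..m. \<bar>X i w - g c (X i w)\<bar>) / real m + (\<eta> / 2 + (W w)\<^sup>2 / (2 * \<eta> * (real m)\<^sup>2)) + t c)"
      using intX tX W2 pw by (intro integral_mono) auto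
    also have "\<dots> = t c + (\<eta> / 2 + expectation (\<lambda>w. (W w)\<^sup>2) / (2 * \<eta> * (real m)\<^sup>2)) + t c"
      using intX tX W2 m by (simp add: prob_space)
    also have "expectation (\<lambda>w. (W w)\<^sup>2) / (2 * \<eta> * (real m)\<^sup>2) \<le> (m * (2 * \<bar>c\<bar>)\<^sup>2) / (2 * \<eta> * (real m)\<^sup>2)"
      using W2 \<eta> by (intro divide_right_mono) auto
    also have "(m * (2 * \<bar>c\<bar>)\<^sup>2) / (2 * \<eta> * (real m)\<^sup>2) = (2 * \<bar>c\<bar>)\<^sup>2 / (2 * \<eta> * real m)"
      using m by (simp add: power2_eq_square)
    finally show ?thesis by simp
  qed
  have nonneg: "0 \<le> expectation (\<lambda>w. \<bar>(\<Sum>i=1..m. X i w) / real m - \<mu>\<bar>)" for m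
    by (intro integral_nonneg_AE) auto
  show ?thesis
    unfolding \<mu>_def[symmetric]
  proof (rule LIMSEQ_I)
    fix r :: real assume r: "0 < r"
    \<comment> \<open>The two tails together take less than \<open>r / 4\<close>, the choice
      \<open>\<eta> = r / 2\<close> costs \<open>r / 4\<close>, and \<open>N\<close> brings the
      variance term below \<open>r / 4\<close>.\<close>
    have "\<forall>\<^sub>F k in sequentially. t (real k) < r / 8"
      using t_lim r by (intro order_tendstoD(2)) auto
    then obtain k where k: "t (real k) < r / 8" by (auto simp: eventually_sequentially)
    obtain N :: nat where N: "4 * (2 * \<bar>real k\<bar>)\<^sup>2 / r\<^sup>2 < real N" using reals_Archimedean2 by blast
    show "\<exists>N. \<forall>m\<ge>N. norm (expectation (\<lambda>w. \<bar>(\<Sum>i=1..m. X i w) / real m - \<mu>\<bar>) - 0) < r"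
    proof (intro exI[of _ "Suc N"] allI impI)
      fix m assume m: "Suc N \<le> m"
      then have "4 * (2 * \<bar>real k\<bar>)\<^sup>2 / r\<^sup>2 < real m" using N by simp
      then have "(2 * \<bar>real k\<bar>)\<^sup>2 / (2 * (r / 2) * real m) < r / 4"
        using r m by (simp add: field_simps power2_eq_square)
      then show "norm (expectation (\<lambda>w. \<bar>(\<Sum>i=1..m. X i w) / real m - \<mu>\<bar>) - 0) < r"
        using est[of m "r / 2" "real k"] nonneg[of m] r k m by simp
    qed
  qed
qed

section \<open>Monotonicity of the expected volume radius\<close>

lemma vol_radius_cball:
  assumes "0 \<le> r"
  shows "vol_radius (cball (0::'a::euclidean_space) r) = r * vol_radius (cball (0::'a) 1)"
proof (cases "r = 0")
  case True
  then show ?thesis by (simp add: vol_radius_def)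
next
  case False
  have "cball (0::'a) r = (*\<^sub>R) r ` cball 0 1"
  proof
    show "cball (0::'a) r \<subseteq> (*\<^sub>R) r ` cball 0 1"
    proof
      fix x :: 'a assume "x \<in> cball 0 r"
      then show "x \<in> (*\<^sub>R) r ` cball 0 1"
        using False assms by (intro image_eqI[of _ _ "(1 / r) *\<^sub>R x"]) (auto simp: divide_simps)
    qed
    show "(*\<^sub>R) r ` cball 0 1 \<subseteq> cball (0::'a) r"
      using assms by (auto simp: mult_left_le)
  qed
  then show ?thesis by (simp add: vol_radius_scaleR[OF assms])
qed

lemma vol_radius_le_of_subset_cball:
  fixes S :: "'a::euclidean_space set"
  assumes "S \<in> sets lebesgue" "S \<subseteq> cball 0 r" "0 \<le> r"
  shows "vol_radius S \<le> r * vol_radius (cball (0::'a) 1)"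
  using vol_radius_mono[OF assms(2,1) lmeasurable_cball] vol_radius_cball[OF assms(3), where 'a = 'a] by simp

lemma vol_radius_minkowski_mean:
  "vol_radius (minkowski_mean A m) = vol_radius (\<Sum>i=1..m. A i) / real m"
  unfolding minkowski_mean_def by (simp add: vol_radius_scaleR)

text \<open>Boundedness makes the norm finite; \<open>enn2real\<close> would send an infinite norm
  to 0.\<close>

lemma bounded_subset_cball_set_norm:
  assumes "bounded A"
  shows "A \<subseteq> cball 0 (enn2real (set_norm A))"
proof
  fix x assume x: "x \<in> A"
  obtain B where B: "\<And>x. x \<in> A \<Longrightarrow> norm x \<le> B" using assms by (auto simp: bounded_iff)
  have "set_norm A \<le> ennreal B"
    unfolding set_norm_def by (intro SUP_least ennreal_leI B)
  then have fin: "set_norm A < \<top>" by (simp add: le_less_trans)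
  have "ennreal (norm x) \<le> set_norm A"
    unfolding set_norm_def using x by (rule SUP_upper)
  then have "enn2real (ennreal (norm x)) \<le> enn2real (set_norm A)"
    using fin by (intro enn2real_mono) auto
  then show "x \<in> cball 0 (enn2real (set_norm A))" by simp
qed

lemma sum_set_subset_cball:
  fixes A :: "'i \<Rightarrow> 'a::real_normed_vector set"
  assumes "\<And>i. i \<in> I \<Longrightarrow> A i \<subseteq> cball 0 (r i)"
  shows "(\<Sum>i\<in>I. A i) \<subseteq> cball 0 (\<Sum>i\<in>I. r i)"
proof (cases "finite I")
  case True
  show ?thesis
  proof
    fix x assume "x \<in> (\<Sum>i\<in>I. A i)"
    then obtain s where "x = sum s I" "\<forall>i\<in>I. s i \<in> A i"
      using True by (auto simp: set_sum_alt)
    then show "x \<in> cball 0 (\<Sum>i\<in>I. r i)"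
      using assms by (auto intro!: sum_norm_le) (meson mem_cball_0 subsetD)
  qed
qed simp

text \<open>The norm exceeds \<open>y\<close> exactly when the set hits the open set of points of
  norm above \<open>y\<close>, so upper level sets are hitting events.\<close>

lemma set_norm_measurable: "set_norm \<in> borel_measurable closed_sets_borel"
proof (rule borel_measurableI_greater)
  fix y :: ennreal
  have "open {x::'a. y < ennreal (norm x)}"
    by (intro open_Collect_less continuous_on_ennreal continuous_intros)
  then have "{F. closed F \<and> F \<inter> {x::'a. y < ennreal (norm x)} \<noteq> {}} \<in> sets closed_sets_borel"
    by (rule sets_closed_sets_borel_hit_open)
  also have "{F. closed F \<and> F \<inter> {x::'a. y < ennreal (norm x)} \<noteq> {}} = {F \<in> space closed_sets_borel. y < set_norm F}"
    by (auto simp: space_closed_sets_borel set_norm_def less_SUP_iff)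
  finally show "{F \<in> space closed_sets_borel. y < set_norm (F :: 'a set)} \<in> sets closed_sets_borel" .
qed

lemma scaleR_image_sum_set:
  fixes A :: "'i \<Rightarrow> 'a::real_vector set"
  shows "(*\<^sub>R) c ` (\<Sum>i\<in>I. A i) = (\<Sum>i\<in>I. (*\<^sub>R) c ` A i)"
proof -
  have "(*\<^sub>R) c ` A + (*\<^sub>R) c ` B = (*\<^sub>R) c ` (A + B)" for A B :: "'a set"
    by (force simp: set_plus_def scaleR_add_right)
  then show ?thesis
    using sum_set_linear[of "image ((*\<^sub>R) c)" A I] by (simp add: comp_def)
qed

text \<open>The average of finitely many points of a convex set stays in the set. This is where
  monotonicity draws on the convexity of the summands.\<close>

lemma convex_repeated_sum_subset:
  fixes A :: "'a::real_vector set"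
  assumes "convex A" "finite J" "J \<noteq> {}"
  shows "(\<Sum>j\<in>J. A) \<subseteq> (*\<^sub>R) (real (card J)) ` A"
proof
  fix x assume "x \<in> (\<Sum>j\<in>J. A)"
  then obtain s where s: "x = sum s J" "\<forall>j\<in>J. s j \<in> A"
    using assms(2) by (auto simp: set_sum_alt)
  have "(\<Sum>j\<in>J. (1 / real (card J)) *\<^sub>R s j) \<in> A"
    using assms s(2) by (intro convex_sum) auto
  moreover have "x = real (card J) *\<^sub>R (\<Sum>j\<in>J. (1 / real (card J)) *\<^sub>R s j)"
    using assms by (simp add: s(1) scaleR_sum_right)
  ultimately show "x \<in> (*\<^sub>R) (real (card J)) ` A" by blast
qed

text \<open>Every summand occurs in all but one of the leave-one-out sums.\<close>

lemma vol_radius_leave_one_out: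
  fixes A :: "'i \<Rightarrow> 'a::euclidean_space set"
  assumes I: "finite I" "2 \<le> card I"
    and A: "\<And>i. i \<in> I \<Longrightarrow> compact (A i) \<and> convex (A i) \<and> A i \<noteq> {}"
  shows "(\<Sum>j\<in>I. vol_radius (\<Sum>i\<in>I - {j}. A i)) \<le> (real (card I) - 1) * vol_radius (\<Sum>i\<in>I. A i)"
proof -
  let ?c = "real (card I) - 1"
  have "(\<Sum>j\<in>I. vol_radius (\<Sum>i\<in>I - {j}. A i)) \<le> vol_radius (\<Sum>j\<in>I. \<Sum>i\<in>I - {j}. A i)"
    using A by (intro brunn_minkowski_sum compact_sum_set sum_set_nonempty) auto
  also have "\<dots> \<le> vol_radius ((*\<^sub>R) ?c ` (\<Sum>i\<in>I. A i))"
  proof (rule vol_radius_mono)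
    have eq: "I - {j} = {i \<in> I. j \<noteq> i}" "I - {j} = {i \<in> I. i \<noteq> j}" for j by auto
    have "(\<Sum>j\<in>I. \<Sum>i\<in>I - {j}. A i) = (\<Sum>i\<in>I. \<Sum>j\<in>I - {i}. A i)"
      using sum.swap_restrict[OF I(1) I(1), of "\<lambda>j i. A i" "\<lambda>j i. j \<noteq> i"] unfolding eq(1) by (simp add: eq(1)[symmetric] eq(2)[symmetric])
    also have "\<dots> \<subseteq> (\<Sum>i\<in>I. (*\<^sub>R) ?c ` A i)"
    proof -
      have sub: "(\<Sum>j\<in>I - {i}. A i) \<subseteq> (*\<^sub>R) ?c ` A i" if i: "i \<in> I" for i
      proof -
        have "card (I - {i}) = card I - 1" using I i by simp
        moreover from this have "I - {i} \<noteq> {}" using I by (metis card.empty diff_is_0_eq not_less_eq_eq numeral_2_eq_2 One_nat_def)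
        ultimately show ?thesis
          using convex_repeated_sum_subset[of "A i" "I - {i}"] A[OF i] I by (simp add: of_nat_diff)
      qed
      have "(\<Sum>i\<in>J. \<Sum>j\<in>I - {i}. A i) \<subseteq> (\<Sum>i\<in>J. (*\<^sub>R) ?c ` A i)" if "J \<subseteq> I" for J
        using finite_subset[OF that I(1)] that
        by (induction J rule: finite_induct) (simp_all add: set_plus_mono2 sub)
      then show ?thesis by blast
    qed
    also have "\<dots> = (*\<^sub>R) ?c ` (\<Sum>i\<in>I. A i)" by (rule scaleR_image_sum_set[symmetric])
    finally show "(\<Sum>j\<in>I. \<Sum>i\<in>I - {j}. A i) \<subseteq> (*\<^sub>R) ?c ` (\<Sum>i\<in>I. A i)" .
    show "(\<Sum>j\<in>I. \<Sum>i\<in>I - {j}. A i) \<in> sets lebesgue"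
      using A by (intro fmeasurableD lmeasurable_compact compact_sum_set) auto
    show "(*\<^sub>R) ?c ` (\<Sum>i\<in>I. A i) \<in> lmeasurable"
      using A by (intro lmeasurable_compact compact_scaling compact_sum_set) auto
  qed
  also have "\<dots> = ?c * vol_radius (\<Sum>i\<in>I. A i)"
    using I by (intro vol_radius_scaleR) auto
  finally show ?thesis .
qed

section \<open>Sequences of i.i.d. random convex sets\<close>

locale iid_convex_sets = prob_space P for P :: "'w measure" +
  fixes K :: "nat \<Rightarrow> 'w \<Rightarrow> 'a::euclidean_space set"
  assumes random: "\<And>i. random_compact_convex_set P (K i)"
    and nonempty: "\<And>i. AE w in P. K i w \<noteq> {}"
    and indep: "indep_vars (\<lambda>_. closed_sets_borel) K UNIV"
    and ident: "\<And>i. distr P closed_sets_borel (K i) = distr P closed_sets_borel (K 0)"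
    and norm_finite: "(\<integral>\<^sup>+ w. set_norm (K 0 w) \<partial>P) < \<infinity>"
begin

lemma K_measurable: "K i \<in> P \<rightarrow>\<^sub>M closed_sets_borel"
  using random[of i] by (simp add: random_compact_convex_set_def random_closed_set_def)

lemma AE_convex_body: "AE w in P. \<forall>i. compact (K i w) \<and> convex (K i w) \<and> K i w \<noteq> {}"
  unfolding AE_all_countable
proof
  fix i
  show "AE w in P. compact (K i w) \<and> convex (K i w) \<and> K i w \<noteq> {}"
    using random[of i] nonempty[of i] unfolding random_compact_convex_set_def by auto
qed

definition radius :: "nat \<Rightarrow> 'w \<Rightarrow> real" where
  "radius i w = enn2real (set_norm (K i w))"

lemma radius_nonneg: "0 \<le> radius i w"
  by (simp add: radius_def)

lemma integrable_radius: "integrable P (radius i)"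
  and expectation_radius: "expectation (radius i) = expectation (radius 0)"
proof -
  have f: "(\<lambda>F. enn2real (set_norm F)) \<in> borel_measurable (closed_sets_borel :: 'a set measure)"
    using set_norm_measurable by measurable
  have "radius 0 \<in> borel_measurable P"
    unfolding radius_def using measurable_compose[OF K_measurable f] .
  moreover have "(\<integral>\<^sup>+ w. ennreal (radius 0 w) \<partial>P) < \<infinity>"
  proof -
    have "(\<integral>\<^sup>+ w. ennreal (radius 0 w) \<partial>P) \<le> (\<integral>\<^sup>+ w. set_norm (K 0 w) \<partial>P)"
      unfolding radius_def by (intro nn_integral_mono) (simp add: ennreal_enn2real_if)
    then show ?thesis using norm_finite by (rule le_less_trans)
  qed
  ultimately have "integrable P (radius 0)"
    by (intro integrableI_nonneg) (auto simp: radius_nonneg)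
  then show "integrable P (radius i)" "expectation (radius i) = expectation (radius 0)"
    using integrable_distr_cong[OF K_measurable K_measurable ident f, of i]
    by (simp_all add: radius_def[abs_def])
qed

lemma AE_subset_cball_radius: "AE w in P. \<forall>i. K i w \<subseteq> cball 0 (radius i w)"
  using AE_convex_body
proof eventually_elim
  case (elim w)
  then show ?case
    unfolding radius_def using bounded_subset_cball_set_norm compact_imp_bounded by blast
qed

lemma AE_vol_radius_sum_le:
  assumes "finite I"
  shows "AE w in P. vol_radius (\<Sum>i\<in>I. K i w) \<le> (\<Sum>i\<in>I. radius i w) * vol_radius (cball (0::'a) 1)"
  using AE_convex_body AE_subset_cball_radius
proof eventually_elim
  case (elim w)
  then show ?case
    by (intro vol_radius_le_of_subset_cball sum_set_subset_cball sum_nonneg radius_nonneg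
        fmeasurableD lmeasurable_compact compact_sum_set) auto
qed

lemma vol_radius_sum_measurable: "(\<lambda>w. vol_radius (\<Sum>i\<in>I. K i w)) \<in> borel_measurable P"
  unfolding vol_radius_def using measurable_measure_Minkowski_sum[of I K P] K_measurable by measurable

lemma integrable_vol_radius_sum:
  assumes "finite I"
  shows "integrable P (\<lambda>w. vol_radius (\<Sum>i\<in>I. K i w))"
proof (rule Bochner_Integration.integrable_bound)
  show "integrable P (\<lambda>w. (\<Sum>i\<in>I. radius i w) * vol_radius (cball (0::'a) 1))"
    using integrable_radius by auto
  show "AE w in P. norm (vol_radius (\<Sum>i\<in>I. K i w)) \<le> norm ((\<Sum>i\<in>I. radius i w) * vol_radius (cball (0::'a) 1))"
    using AE_vol_radius_sum_le[OF assms]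
    by eventually_elim (simp add: vol_radius_nonneg sum_nonneg radius_nonneg)
qed (rule vol_radius_sum_measurable)

text \<open>Independence makes the law of the whole sequence an infinite product of equal factors,
  and picking distinct coordinates of such a product gives a product of the same factors again.
  Expected volume radii of sums therefore depend only on the number of summands.\<close>

lemma distr_reindexed:
  assumes "inj_on g J" "finite J"
  shows "distr P (\<Pi>\<^sub>M j\<in>J. closed_sets_borel) (\<lambda>w. \<lambda>j\<in>J. K (g j) w)
    = (\<Pi>\<^sub>M j\<in>J. distr P closed_sets_borel (K 0))"
proof -
  let ?D = "distr P closed_sets_borel (K 0)"
  interpret D: prob_space ?D by (rule prob_space_distr[OF K_measurable])
  let ?U = "\<Pi>\<^sub>M i\<in>(UNIV :: nat set). (closed_sets_borel :: 'a set measure)"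
  let ?J = "\<Pi>\<^sub>M j\<in>J. (closed_sets_borel :: 'a set measure)"
  have sets_J: "sets ?J = sets (\<Pi>\<^sub>M j\<in>J. ?D)"
    by (intro sets_PiM_cong) simp_all
  have joint: "distr P (?U) (\<lambda>w i. K i w) = (\<Pi>\<^sub>M i\<in>UNIV. ?D)"
    using indep_vars_iff_distr_eq_PiM[where I = UNIV and M' = "\<lambda>_. closed_sets_borel" and X = K]
      indep K_measurable unfolding ext[of "\<lambda>i. distr P closed_sets_borel (K i)", OF ident] restrict_UNIV by simp
  have m1: "(\<lambda>w i. K i w) \<in> P \<rightarrow>\<^sub>M ?U"
    using K_measurable measurable_space[OF K_measurable] by (intro measurable_PiM_single') auto
  have m2: "(\<lambda>x. \<lambda>j\<in>J. x (g j)) \<in> ?U \<rightarrow>\<^sub>M ?J"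
    by (intro measurable_restrict) simp
  have "distr P ?J (\<lambda>w. \<lambda>j\<in>J. K (g j) w) = distr (distr P (?U) (\<lambda>w i. K i w)) ?J (\<lambda>x. \<lambda>j\<in>J. x (g j))"
    by (subst distr_distr[OF m2 m1]) (simp add: comp_def)
  also have "\<dots> = distr (\<Pi>\<^sub>M i\<in>UNIV. ?D) (\<Pi>\<^sub>M j\<in>J. ?D) (\<lambda>x. \<lambda>j\<in>J. x (g j))"
    unfolding joint by (intro distr_cong) (simp_all add: sets_J)
  also have "\<dots> = (\<Pi>\<^sub>M j\<in>J. ?D)"
    using distr_PiM_reindex[of UNIV "\<lambda>_. ?D" g J] assms D.prob_space_axioms by simp
  finally show ?thesis .
qed

lemma expectation_vol_radius_sum_reindex:
  assumes g: "inj_on g J" "finite J"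
  shows "expectation (\<lambda>w. vol_radius (\<Sum>j\<in>J. K (g j) w))
    = (\<integral>x. vol_radius (\<Sum>j\<in>J. x j) \<partial>(\<Pi>\<^sub>M j\<in>J. distr P closed_sets_borel (K 0)))"
proof -
  let ?N = "\<Pi>\<^sub>M j\<in>J. (closed_sets_borel :: 'a set measure)"
  have "(\<lambda>x. vol_radius (\<Sum>j\<in>J. x j)) \<in> borel_measurable ?N"
    unfolding vol_radius_def
    using measurable_measure_Minkowski_sum[of J "\<lambda>j x. x j" ?N] by measurable
  moreover have "(\<lambda>w. \<lambda>j\<in>J. K (g j) w) \<in> P \<rightarrow>\<^sub>M ?N"
    using K_measurable by (intro measurable_restrict) auto
  ultimately show ?thesis
    unfolding distr_reindexed[OF g, symmetric] by (subst integral_distr) simp_all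
qed

lemma expectation_vol_radius_sum_card:
  assumes "finite I" "finite J" "card I = card J"
  shows "expectation (\<lambda>w. vol_radius (\<Sum>i\<in>I. K i w)) = expectation (\<lambda>w. vol_radius (\<Sum>j\<in>J. K j w))"
proof -
  obtain g where g: "bij_betw g J I"
    using assms finite_same_card_bij by metis
  have "(\<Sum>i\<in>I. K i w) = (\<Sum>j\<in>J. K (g j) w)" for w
    using sum.reindex_bij_betw[OF g, of "\<lambda>i. K i w"] by simp
  then show ?thesis
    using expectation_vol_radius_sum_reindex[of g J] expectation_vol_radius_sum_reindex[of id J] g assms
    by (simp add: bij_betw_def)
qed

definition mean_vol :: "nat \<Rightarrow> real" where
  "mean_vol m = expectation (\<lambda>w. vol_radius (minkowski_mean (\<lambda>i. K i w) m))"

lemma mean_vol_eq: "mean_vol m = expectation (\<lambda>w. vol_radius (\<Sum>i=1..m. K i w)) / real m"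
  by (simp add: mean_vol_def vol_radius_minkowski_mean)

lemma mean_vol_Suc_mono:
  assumes "1 \<le> m"
  shows "mean_vol m \<le> mean_vol (Suc m)"
proof -
  let ?I = "{1..Suc m}"
  let ?E = "\<lambda>I. expectation (\<lambda>w. vol_radius (\<Sum>i\<in>I. K i w))"
  have "real (Suc m) * ?E {1..m} = (\<Sum>j\<in>?I. ?E (?I - {j}))"
  proof -
    have "?E (?I - {j}) = ?E {1..m}" if "j \<in> ?I" for j
      using that by (intro expectation_vol_radius_sum_card) auto
    then show ?thesis by simp
  qed
  also have "\<dots> = expectation (\<lambda>w. \<Sum>j\<in>?I. vol_radius (\<Sum>i\<in>?I - {j}. K i w))"
    by (intro Bochner_Integration.integral_sum[symmetric] integrable_vol_radius_sum) auto
  also have "\<dots> \<le> expectation (\<lambda>w. (real (card ?I) - 1) * vol_radius (\<Sum>i\<in>?I. K i w))"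
  proof (rule integral_mono_AE)
    show "AE w in P. (\<Sum>j\<in>?I. vol_radius (\<Sum>i\<in>?I - {j}. K i w))
        \<le> (real (card ?I) - 1) * vol_radius (\<Sum>i\<in>?I. K i w)"
      using AE_convex_body
    proof eventually_elim
      case (elim w)
      then show ?case using assms by (intro vol_radius_leave_one_out) auto
    qed
    show "integrable P (\<lambda>w. \<Sum>j\<in>?I. vol_radius (\<Sum>i\<in>?I - {j}. K i w))"
      by (intro Bochner_Integration.integrable_sum integrable_vol_radius_sum) auto
    show "integrable P (\<lambda>w. (real (card ?I) - 1) * vol_radius (\<Sum>i\<in>?I. K i w))"
      by (intro integrable_mult_right integrable_vol_radius_sum) auto
  qed
  also have "\<dots> = real m * ?E ?I" by simp
  \<comment> \<open>The chain gives \<open>(m + 1) * E_m \<le> m * E_(m+1)\<close> for the undivided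
    sums; dividing by \<open>m * (m + 1)\<close> yields the means.\<close>
  finally show ?thesis
    unfolding mean_vol_eq using assms by (simp add: field_simps)
qed

lemma mean_vol_mono: "mono_on {1..} mean_vol"
proof (rule mono_onI)
  fix m n :: nat assume m: "m \<in> {1..}" and "m \<le> n"
  from this(2) show "mean_vol m \<le> mean_vol n"
  proof (induction n rule: dec_induct)
    case (step n)
    then show ?case using m mean_vol_Suc_mono[of n] by simp
  qed simp
qed

end

section \<open>Support functions and the limit\<close>

text \<open>Taking the supremum in \<open>ereal\<close> first makes the map Borel measurable on all closed sets,
  including the empty and the unbounded ones, where its real value is junk.\<close>

definition support_fun :: "'a::euclidean_space \<Rightarrow> 'a set \<Rightarrow> real" where
  "support_fun u F = real_of_ereal (SUP x\<in>F. ereal (u \<bullet> x))"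

lemma support_fun_measurable: "support_fun u \<in> borel_measurable closed_sets_borel"
proof -
  have "(\<lambda>F. SUP x\<in>F. ereal (u \<bullet> x)) \<in> borel_measurable closed_sets_borel"
  proof (rule borel_measurableI_greater)
    fix y :: ereal
    have "open {x. y < ereal (u \<bullet> x)}"
      by (intro open_Collect_less continuous_on_ereal continuous_intros)
    then have "{F. closed F \<and> F \<inter> {x. y < ereal (u \<bullet> x)} \<noteq> {}} \<in> sets closed_sets_borel"
      by (rule sets_closed_sets_borel_hit_open)
    also have "{F. closed F \<and> F \<inter> {x. y < ereal (u \<bullet> x)} \<noteq> {}}
        = {F \<in> space closed_sets_borel. y < (SUP x\<in>F. ereal (u \<bullet> x))}"
      by (auto simp: space_closed_sets_borel less_SUP_iff)
    finally show "{F \<in> space closed_sets_borel. y < (SUP x\<in>F. ereal (u \<bullet> x))} \<in> sets closed_sets_borel" .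
  qed
  then show ?thesis unfolding support_fun_def by measurable
qed

lemma support_fun_attained:
  assumes "compact F" "F \<noteq> {}"
  obtains x where "x \<in> F" "u \<bullet> x = support_fun u F" "\<And>y. y \<in> F \<Longrightarrow> u \<bullet> y \<le> support_fun u F"
proof -
  obtain x where x: "x \<in> F" "\<And>y. y \<in> F \<Longrightarrow> u \<bullet> y \<le> u \<bullet> x"
    using continuous_attains_sup[OF assms continuous_on_inner[OF continuous_on_const continuous_on_id]] by blast
  then have "(SUP y\<in>F. ereal (u \<bullet> y)) = ereal (u \<bullet> x)"
    by (intro SUP_eqI) auto
  then have "support_fun u F = u \<bullet> x" by (simp add: support_fun_def)
  with x show thesis by (intro that[of x]) auto
qed

lemma support_fun_upper:
  assumes "compact F" "y \<in> F"
  shows "u \<bullet> y \<le> support_fun u F"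
  using support_fun_attained[of F u] assms by blast

lemma support_fun_abs_le:
  assumes "compact F" "F \<noteq> {}" "F \<subseteq> cball 0 r"
  shows "\<bar>support_fun u F\<bar> \<le> norm u * r"
proof -
  obtain x where x: "x \<in> F" "u \<bullet> x = support_fun u F"
    using support_fun_attained[OF assms(1,2)] by blast
  have "\<bar>u \<bullet> x\<bar> \<le> norm u * norm x" by (rule Cauchy_Schwarz_ineq2)
  also have "\<dots> \<le> norm u * r" using x(1) assms(3) by (intro mult_left_mono) auto
  finally show ?thesis by (simp add: x(2))
qed

lemma support_fun_diff_le:
  assumes "compact F" "F \<noteq> {}" "F \<subseteq> cball 0 r"
  shows "\<bar>support_fun u F - support_fun v F\<bar> \<le> norm (u - v) * r"
proof -
  have *: "support_fun u F - support_fun v F \<le> norm (u - v) * r" for u v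
  proof -
    obtain x where x: "x \<in> F" "u \<bullet> x = support_fun u F"
      using support_fun_attained[OF assms(1,2)] by blast
    have "support_fun u F - support_fun v F \<le> (u - v) \<bullet> x"
      using support_fun_upper[OF assms(1) x(1), of v] by (simp add: x(2)[symmetric] inner_diff_left)
    also have "\<dots> \<le> norm (u - v) * norm x" by (rule norm_cauchy_schwarz)
    also have "\<dots> \<le> norm (u - v) * r" using x(1) assms(3) by (intro mult_left_mono) auto
    finally show ?thesis .
  qed
  show ?thesis using *[of u v] *[of v u] by (simp add: norm_minus_commute abs_le_iff)
qed

text \<open>Together with the next lemma this identifies the support function of the mean as the
  mean of the support functions. For \<open>m = 0\<close> both sides vanish, since the mean is then
  \<open>{0}\<close> and division by zero gives 0.\<close>

lemma minkowski_mean_support_upper: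
  assumes "\<And>i. i \<in> {1..m} \<Longrightarrow> compact (A i)" "x \<in> minkowski_mean A m"
  shows "u \<bullet> x \<le> (\<Sum>i=1..m. support_fun u (A i)) / real m"
proof -
  obtain s where s: "\<forall>i\<in>{1..m}. s i \<in> A i" "x = (1 / real m) *\<^sub>R sum s {1..m}"
    using assms(2) by (auto simp: minkowski_mean_def set_sum_alt)
  have "(\<Sum>i=1..m. u \<bullet> s i) \<le> (\<Sum>i=1..m. support_fun u (A i))"
    using s(1) assms(1) by (intro sum_mono support_fun_upper) auto
  then show ?thesis by (simp add: s(2) inner_sum_right divide_right_mono)
qed

lemma minkowski_mean_support_attained:
  assumes "\<And>i. i \<in> {1..m} \<Longrightarrow> compact (A i) \<and> A i \<noteq> {}"
  shows "\<exists>x\<in>minkowski_mean A m. u \<bullet> x = (\<Sum>i=1..m. support_fun u (A i)) / real m"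
proof -
  have "\<forall>i\<in>{1..m}. \<exists>x. x \<in> A i \<and> u \<bullet> x = support_fun u (A i)"
    using assms support_fun_attained by metis
  then obtain s where s: "\<forall>i\<in>{1..m}. s i \<in> A i \<and> u \<bullet> s i = support_fun u (A i)" by metis
  then have "(1 / real m) *\<^sub>R sum s {1..m} \<in> minkowski_mean A m"
    by (auto simp: minkowski_mean_def set_sum_alt)
  moreover have "u \<bullet> ((1 / real m) *\<^sub>R sum s {1..m}) = (\<Sum>i=1..m. support_fun u (A i)) / real m"
    using s by (simp add: inner_sum_right)
  ultimately show ?thesis by blast
qed

lemma minkowski_mean_compact_convex:
  fixes A :: "nat \<Rightarrow> 'a::euclidean_space set"
  assumes "\<And>i. i \<in> {1..m} \<Longrightarrow> compact (A i) \<and> convex (A i)"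
  shows "compact (minkowski_mean A m)" "convex (minkowski_mean A m)"
  unfolding minkowski_mean_def using assms
  by (auto intro!: compact_scaling compact_sum_set convex_scaling convex_set_sum)

text \<open>A point outside could be strictly separated from \<open>S\<close>. Asking only for a
  point of \<open>S\<close> at least as far in each unit direction avoids naming the support
  function of \<open>S\<close>.\<close>

lemma convex_mem_of_support_le:
  fixes S :: "'a::euclidean_space set"
  assumes "convex S" "closed S" "S \<noteq> {}"
    and "\<And>u. norm u = 1 \<Longrightarrow> \<exists>x\<in>S. u \<bullet> z \<le> u \<bullet> x"
  shows "z \<in> S"
proof (rule ccontr)
  assume "z \<notin> S"
  then obtain a b where ab: "a \<bullet> z < b" "\<And>x. x \<in> S \<Longrightarrow> b < a \<bullet> x"
    using separating_hyperplane_closed_point[OF assms(1,2)] by blast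
  have "a \<noteq> 0" using ab assms(3) by force
  \<comment> \<open>The separation puts \<open>S\<close> on the larger side of \<open>a\<close>, so
    the direction that contradicts it is \<open>-a\<close>, normalized.\<close>
  then obtain x where x: "x \<in> S" "(- (1 / norm a) *\<^sub>R a) \<bullet> z \<le> (- (1 / norm a) *\<^sub>R a) \<bullet> x"
    using assms(4)[of "- (1 / norm a) *\<^sub>R a"] by auto
  then have "a \<bullet> x \<le> a \<bullet> z" using \<open>a \<noteq> 0\<close> by (simp add: divide_right_mono field_simps)
  then show False using ab(1) ab(2)[OF x(1)] by simp
qed

text \<open>The law of large numbers acts on one direction at a time; a finite net makes it uniform
  over the sphere.\<close>

lemma sphere_finite_net:
  assumes "0 < \<eta>"
  obtains U :: "'a::euclidean_space set" where "finite U"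
    "\<forall>u. norm u = 1 \<longrightarrow> (\<exists>v\<in>U. norm (u - v) \<le> \<eta>)"
proof -
  obtain U :: "'a set" where "finite U" "sphere 0 1 \<subseteq> (\<Union>x\<in>U. ball x \<eta>)"
    using compact_eq_totally_bounded[of "sphere (0::'a) 1"] assms by auto
  moreover have "\<exists>v\<in>U. norm (u - v) \<le> \<eta>" if "norm u = 1" for u
  proof -
    have "u \<in> sphere 0 1" using that by simp
    then obtain v where "v \<in> U" "u \<in> ball v \<eta>" using calculation(2) by blast
    then show ?thesis by (intro bexI[of _ v]) (auto simp: dist_norm norm_minus_commute)
  qed
  ultimately show thesis using that by blast
qed

section \<open>Mean support function and uniform deviation\<close>

context iid_convex_sets
begin

definition mean_support :: "'a \<Rightarrow> real" where
  "mean_support u = expectation (\<lambda>w. support_fun u (K 0 w))"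

definition mean_radius :: real where
  "mean_radius = expectation (radius 0)"

lemma mean_radius_nonneg: "0 \<le> mean_radius"
  unfolding mean_radius_def by (intro integral_nonneg_AE) (simp add: radius_nonneg)

lemma support_random_measurable: "(\<lambda>w. support_fun u (K i w)) \<in> borel_measurable P"
  using measurable_compose[OF K_measurable support_fun_measurable] .

lemma integrable_support: "integrable P (\<lambda>w. support_fun u (K i w))"
proof (rule Bochner_Integration.integrable_bound)
  show "integrable P (\<lambda>w. norm u * radius i w)" using integrable_radius by simp
  show "AE w in P. norm (support_fun u (K i w)) \<le> norm (norm u * radius i w)"
    using AE_convex_body AE_subset_cball_radius
  proof eventually_elim
    case (elim w)
    then have "\<bar>support_fun u (K i w)\<bar> \<le> norm u * radius i w" by (intro support_fun_abs_le) auto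
    then show ?case by (simp add: radius_nonneg)
  qed
qed (rule support_random_measurable)

lemma mean_support_diff_le: "\<bar>mean_support u - mean_support v\<bar> \<le> norm (u - v) * mean_radius"
proof -
  have "mean_support u - mean_support v = expectation (\<lambda>w. support_fun u (K 0 w) - support_fun v (K 0 w))"
    unfolding mean_support_def using integrable_support by simp
  also have "\<bar>\<dots>\<bar> \<le> expectation (\<lambda>w. \<bar>support_fun u (K 0 w) - support_fun v (K 0 w)\<bar>)"
    by (rule integral_abs_bound)
  also have "\<dots> \<le> expectation (\<lambda>w. norm (u - v) * radius 0 w)"
  proof (rule integral_mono_AE)
    show "AE w in P. \<bar>support_fun u (K 0 w) - support_fun v (K 0 w)\<bar> \<le> norm (u - v) * radius 0 w"
      using AE_convex_body AE_subset_cball_radius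
      by eventually_elim (intro support_fun_diff_le; simp)
  qed (use integrable_support integrable_radius in auto)
  finally show ?thesis by (simp add: mean_radius_def)
qed

lemma mean_support_le:
  assumes "norm u = 1"
  shows "mean_support u \<le> mean_radius"
  unfolding mean_support_def mean_radius_def
proof (rule integral_mono_AE)
  show "AE w in P. support_fun u (K 0 w) \<le> radius 0 w"
    using AE_convex_body AE_subset_cball_radius
  proof eventually_elim
    case (elim w)
    then have "\<bar>support_fun u (K 0 w)\<bar> \<le> norm u * radius 0 w" by (intro support_fun_abs_le) auto
    then show ?case using assms by simp
  qed
qed (use integrable_support integrable_radius in auto)

text \<open>The sum over \<open>U\<close> measures the error at the net points. The second term pays
  for moving from a direction to a net point within \<open>\<eta>\<close>: its two parts are
  Lipschitz constants of the averaged and of the expected support function.\<close>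

definition deviation :: "'a set \<Rightarrow> real \<Rightarrow> nat \<Rightarrow> 'w \<Rightarrow> real" where
  "deviation U \<eta> m w = (\<Sum>v\<in>U. \<bar>(\<Sum>i=1..m. support_fun v (K i w)) / real m - mean_support v\<bar>)
     + \<eta> * ((\<Sum>i=1..m. radius i w) / real m + mean_radius)"

lemma deviation_nonneg: "0 \<le> \<eta> \<Longrightarrow> 0 \<le> deviation U \<eta> m w"
  unfolding deviation_def using mean_radius_nonneg
  by (intro add_nonneg_nonneg sum_nonneg mult_nonneg_nonneg divide_nonneg_nonneg) (auto simp: radius_nonneg)

lemma integrable_deviation: "integrable P (deviation U \<eta> m)"
  unfolding deviation_def[abs_def] using integrable_support integrable_radius by auto

lemma AE_support_deviation:
  assumes U: "finite U" "\<forall>u. norm u = 1 \<longrightarrow> (\<exists>v\<in>U. norm (u - v) \<le> \<eta>)" and m: "1 \<le> m"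
  shows "AE w in P. \<forall>u. norm u = 1 \<longrightarrow>
    \<bar>(\<Sum>i=1..m. support_fun u (K i w)) / real m - mean_support u\<bar> \<le> deviation U \<eta> m w"
  using AE_convex_body AE_subset_cball_radius
proof eventually_elim
  case (elim w)
  show ?case
  proof (intro allI impI)
    fix u :: 'a assume "norm u = 1"
    then obtain v where v: "v \<in> U" "norm (u - v) \<le> \<eta>" using U(2) by blast
    let ?h = "\<lambda>u. (\<Sum>i=1..m. support_fun u (K i w)) / real m"
    let ?r = "(\<Sum>i=1..m. radius i w) / real m"
    have "\<bar>?h u - ?h v\<bar> \<le> \<eta> * ?r"
    proof -
      have "\<bar>\<Sum>i=1..m. support_fun u (K i w) - support_fun v (K i w)\<bar>
          \<le> (\<Sum>i=1..m. \<bar>support_fun u (K i w) - support_fun v (K i w)\<bar>)" by (rule sum_abs)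
      also have "\<dots> \<le> (\<Sum>i=1..m. \<eta> * radius i w)"
      proof (rule sum_mono)
        fix i
        have "\<bar>support_fun u (K i w) - support_fun v (K i w)\<bar> \<le> norm (u - v) * radius i w"
          using elim by (intro support_fun_diff_le) auto
        also have "\<dots> \<le> \<eta> * radius i w" using v(2) radius_nonneg by (intro mult_right_mono)
        finally show "\<bar>support_fun u (K i w) - support_fun v (K i w)\<bar> \<le> \<eta> * radius i w" .
      qed
      finally have "\<bar>\<Sum>i=1..m. support_fun u (K i w) - support_fun v (K i w)\<bar> / real m \<le> \<eta> * (\<Sum>i=1..m. radius i w) / real m"
        by (intro divide_right_mono) (auto simp: sum_distrib_left)
      then show ?thesis by (simp add: sum_subtractf diff_divide_distrib[symmetric] abs_divide)
    qed
    moreover have "\<bar>mean_support u - mean_support v\<bar> \<le> \<eta> * mean_radius"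
      using mean_support_diff_le[of u v] mult_right_mono[OF v(2) mean_radius_nonneg] by linarith
    moreover have "\<bar>?h v - mean_support v\<bar> \<le> (\<Sum>v\<in>U. \<bar>?h v - mean_support v\<bar>)"
      using U(1) v(1) by (intro member_le_sum) auto
    ultimately show "\<bar>?h u - mean_support u\<bar> \<le> deviation U \<eta> m w"
      unfolding deviation_def distrib_left by linarith
  qed
qed

text \<open>The net terms vanish by the law of large numbers, while the Lipschitz term has constant
  expectation for \<open>m \<ge> 1\<close>. The limit is positive in general and is made small by
  refining the net.\<close>

lemma expectation_deviation_tendsto:
  "(\<lambda>m. expectation (deviation U \<eta> m)) \<longlonglongrightarrow> \<eta> * (2 * mean_radius)"
proof -
  have lln: "(\<lambda>m. expectation (\<lambda>w. \<bar>(\<Sum>i=1..m. support_fun v (K i w)) / real m - mean_support v\<bar>)) \<longlonglongrightarrow> 0" for v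
    unfolding mean_support_def
  proof (rule L1_law_of_large_numbers)
    show "indep_vars (\<lambda>_. borel) (\<lambda>i w. support_fun v (K i w)) UNIV"
      using support_fun_measurable by (intro indep_vars_compose2[OF indep])
    show "distr P borel (\<lambda>w. support_fun v (K i w)) = distr P borel (\<lambda>w. support_fun v (K 0 w))" for i
    proof -
      have "distr P borel (\<lambda>w. support_fun v (K j w)) = distr (distr P closed_sets_borel (K j)) borel (support_fun v)" for j
        by (subst distr_distr[OF support_fun_measurable K_measurable]) (simp add: comp_def)
      then show ?thesis using ident[of i] by simp
    qed
  qed (rule integrable_support)
  have eq: "expectation (deviation U \<eta> m)
      = (\<Sum>v\<in>U. expectation (\<lambda>w. \<bar>(\<Sum>i=1..m. support_fun v (K i w)) / real m - mean_support v\<bar>))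
        + \<eta> * (2 * mean_radius)" if m: "1 \<le> m" for m
  proof -
    have "expectation (deviation U \<eta> m)
      = (\<Sum>v\<in>U. expectation (\<lambda>w. \<bar>(\<Sum>i=1..m. support_fun v (K i w)) / real m - mean_support v\<bar>))
        + \<eta> * ((\<Sum>i=1..m. expectation (radius i)) / real m + mean_radius)"
      unfolding deviation_def[abs_def] using integrable_support integrable_radius
      by (simp add: prob_space Bochner_Integration.integral_sum)
    moreover have "(\<Sum>i=1..m. expectation (radius i)) = real m * mean_radius"
      by (subst sum.cong[OF refl expectation_radius]) (simp add: mean_radius_def)
    ultimately show ?thesis using m by simp
  qed
  have "(\<lambda>m. (\<Sum>v\<in>U. expectation (\<lambda>w. \<bar>(\<Sum>i=1..m. support_fun v (K i w)) / real m - mean_support v\<bar>))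
        + \<eta> * (2 * mean_radius)) \<longlonglongrightarrow> (\<Sum>v\<in>U. 0) + \<eta> * (2 * mean_radius)"
    by (intro tendsto_add tendsto_sum lln tendsto_const)
  then show ?thesis
    by (rule Lim_transform_eventually[THEN tendsto_eq_rhs])
      (use eq in \<open>auto simp: eventually_sequentially intro!: exI[of _ 1]\<close>)
qed

text \<open>\<open>body 0\<close> is the convex body with support function \<open>mean_support\<close>.\<close>

definition body :: "real \<Rightarrow> 'a set" where
  "body \<epsilon> = {x. \<forall>u. norm u = 1 \<longrightarrow> u \<bullet> x \<le> mean_support u + \<epsilon>}"

lemma body_mono: "\<delta> \<le> \<epsilon> \<Longrightarrow> body \<delta> \<subseteq> body \<epsilon>"
  unfolding body_def by force

lemma closed_body: "closed (body \<epsilon>)"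
proof -
  have "body \<epsilon> = (\<Inter>u\<in>sphere 0 1. {x. u \<bullet> x \<le> mean_support u + \<epsilon>})"
    by (auto simp: body_def)
  then show ?thesis by (simp add: closed_INT closed_halfspace_le)
qed

lemma convex_body_set: "convex (body \<epsilon>)"
proof -
  have "body \<epsilon> = (\<Inter>u\<in>sphere 0 1. {x. u \<bullet> x \<le> mean_support u + \<epsilon>})"
    by (auto simp: body_def)
  then show ?thesis by (simp add: convex_INT convex_halfspace_le)
qed

text \<open>Each nonzero point is tested in its own direction, where its inner product is its
  norm.\<close>

lemma body_subset_cball:
  assumes "0 \<le> \<epsilon>"
  shows "body \<epsilon> \<subseteq> cball 0 (mean_radius + \<epsilon>)"
proof
  fix x assume x: "x \<in> body \<epsilon>"
  show "x \<in> cball 0 (mean_radius + \<epsilon>)"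
  proof (cases "x = 0")
    case True
    then show ?thesis using assms mean_radius_nonneg by simp
  next
    case False
    let ?u = "(1 / norm x) *\<^sub>R x"
    have u: "norm ?u = 1" using False by simp
    then have "?u \<bullet> x \<le> mean_support ?u + \<epsilon>" using x unfolding body_def by blast
    moreover have "?u \<bullet> x = norm x" using False by (simp add: dot_square_norm power2_eq_square)
    ultimately show ?thesis using mean_support_le[OF u] by simp
  qed
qed

lemma compact_body: "0 \<le> \<epsilon> \<Longrightarrow> compact (body \<epsilon>)"
  using closed_body body_subset_cball by (meson bounded_cball bounded_subset compact_eq_bounded_closed)

text \<open>Continuity from above along a decreasing sequence of compact sets takes the place of a
  quantitative estimate of parallel volumes.\<close>

lemma vol_radius_body_tendsto: "(\<lambda>k. vol_radius (body (1 / real (Suc k)))) \<longlonglongrightarrow> vol_radius (body 0)"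
proof -
  let ?e = "\<lambda>k. 1 / real (Suc k)"
  have "(\<lambda>k. measure lebesgue (body (?e k))) \<longlonglongrightarrow> measure lebesgue (\<Inter>k. body (?e k))"
  proof (rule Lim_measure_decseq)
    show "range (\<lambda>k. body (?e k)) \<subseteq> sets lebesgue"
      by (auto intro!: fmeasurableD lmeasurable_compact compact_body)
    show "decseq (\<lambda>k. body (?e k))"
      by (intro decseq_SucI body_mono) (simp add: divide_simps)
    show "emeasure lebesgue (body (?e k)) \<noteq> \<infinity>" for k
      unfolding infinity_ennreal_def by (intro fmeasurableD2 lmeasurable_compact compact_body) simp
  qed
  moreover have "(\<Inter>k. body (?e k)) = body 0"
  proof
    show "body 0 \<subseteq> (\<Inter>k. body (?e k))" by (intro INT_greatest body_mono) simp
    show "(\<Inter>k. body (?e k)) \<subseteq> body 0"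
    proof
      fix x assume x: "x \<in> (\<Inter>k. body (?e k))"
      have "u \<bullet> x \<le> mean_support u + 0" if "norm u = 1" for u
      proof (rule LIMSEQ_le_const)
        show "(\<lambda>k. mean_support u + ?e k) \<longlonglongrightarrow> mean_support u + 0"
          using LIMSEQ_inverse_real_of_nat by (intro tendsto_add tendsto_const) (simp add: inverse_eq_divide)
        show "\<exists>N. \<forall>k\<ge>N. u \<bullet> x \<le> mean_support u + ?e k"
          using x that by (auto simp: body_def)
      qed
      then show "x \<in> body 0" by (simp add: body_def)
    qed
  qed
  ultimately show ?thesis
    unfolding vol_radius_def by (intro tendsto_powr') auto
qed

lemma integrable_vol_radius_mean: "integrable P (\<lambda>w. vol_radius (minkowski_mean (\<lambda>i. K i w) m))"
  unfolding vol_radius_minkowski_mean using integrable_vol_radius_sum[of "{1..m}"] by simp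

section \<open>Two-sided bounds on the expected volume radius\<close>

text \<open>Where the deviation \<open>d\<close> is at most \<open>\<delta>\<close>, the mean lies
  in \<open>body \<delta>\<close>. Elsewhere it lies in a ball of radius
  \<open>mean_radius + d\<close>, and \<open>d > \<delta>\<close> turns this into the multiple
  \<open>(mean_radius / \<delta> + 1) * d\<close>. Adding the two bounds gives one that is linear in
  \<open>d\<close> and can be integrated.\<close>

lemma mean_vol_upper:
  assumes U: "finite U" "\<forall>u. norm u = 1 \<longrightarrow> (\<exists>v\<in>U. norm (u - v) \<le> \<eta>)" "0 \<le> \<eta>"
    and m: "1 \<le> m" and \<delta>: "0 < \<delta>"
  shows "mean_vol m \<le> vol_radius (body \<delta>)
    + (mean_radius / \<delta> + 1) * vol_radius (cball (0::'a) 1) * expectation (deviation U \<eta> m)"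
proof -
  let ?c = "(mean_radius / \<delta> + 1) * vol_radius (cball (0::'a) 1)"
  have c: "0 \<le> ?c" using mean_radius_nonneg \<delta>
    by (intro mult_nonneg_nonneg vol_radius_nonneg add_nonneg_nonneg divide_nonneg_pos) auto
  have "mean_vol m \<le> expectation (\<lambda>w. vol_radius (body \<delta>) + ?c * deviation U \<eta> m w)"
    unfolding mean_vol_def
  proof (rule integral_mono_AE)
    show "AE w in P. vol_radius (minkowski_mean (\<lambda>i. K i w) m) \<le> vol_radius (body \<delta>) + ?c * deviation U \<eta> m w"
      using AE_convex_body AE_support_deviation[OF U(1,2) m]
    proof eventually_elim
      case (elim w)
      let ?M = "minkowski_mean (\<lambda>i. K i w) m" and ?d = "deviation U \<eta> m w"
      have d: "0 \<le> ?d" using U(3) by (rule deviation_nonneg)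
      have M: "?M \<in> sets lebesgue"
        using elim(1) by (intro fmeasurableD lmeasurable_compact minkowski_mean_compact_convex) auto
      have sub: "?M \<subseteq> body ?d"
      proof
        fix x assume x: "x \<in> ?M"
        have "u \<bullet> x \<le> mean_support u + ?d" if "norm u = 1" for u
          using minkowski_mean_support_upper[OF _ x, of u] elim that by fastforce
        then show "x \<in> body ?d" by (simp add: body_def)
      qed
      show ?case
      proof (cases "?d \<le> \<delta>")
        case True
        then have "vol_radius ?M \<le> vol_radius (body \<delta>)"
          using sub body_mono[OF True] M \<delta> by (intro vol_radius_mono lmeasurable_compact compact_body) auto
        moreover have "0 \<le> ?c * ?d" using c d by simp
        ultimately show ?thesis by simp
      next
        case False
        have "vol_radius ?M \<le> (mean_radius + ?d) * vol_radius (cball (0::'a) 1)"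
          using sub body_subset_cball[OF d] M d mean_radius_nonneg
          by (intro vol_radius_le_of_subset_cball) auto
        also have "\<dots> \<le> (mean_radius / \<delta> + 1) * ?d * vol_radius (cball (0::'a) 1)"
        proof -
          have "mean_radius * \<delta> \<le> mean_radius * ?d"
            using False mean_radius_nonneg by (intro mult_left_mono) auto
          then have "mean_radius + ?d \<le> (mean_radius / \<delta> + 1) * ?d"
            using \<delta> by (simp add: field_simps)
          then show ?thesis using vol_radius_nonneg by (rule mult_right_mono)
        qed
        finally have "vol_radius ?M \<le> ?c * ?d" by (simp add: mult_ac)
        then show ?thesis using vol_radius_nonneg[of "body \<delta>"] by simp
      qed
    qed
  qed (use integrable_vol_radius_mean integrable_deviation in auto)
  also have "\<dots> = vol_radius (body \<delta>) + ?c * expectation (deviation U \<eta> m)"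
    using integrable_deviation by (simp add: prob_space)
  finally show ?thesis .
qed

text \<open>A convex body whose support function is at least \<open>(1 - t) s(u) + t \<langle>u, c\<rangle>\<close> contains \<open>(1 - t) body 0 + t c\<close>.\<close>

lemma mean_vol_lower:
  assumes U: "finite U" "\<forall>u. norm u = 1 \<longrightarrow> (\<exists>v\<in>U. norm (u - v) \<le> \<eta>)" "0 \<le> \<eta>"
    and m: "1 \<le> m" and \<rho>: "0 < \<rho>" "cball c \<rho> \<subseteq> body 0"
  shows "(1 - expectation (deviation U \<eta> m) / \<rho>) * vol_radius (body 0) \<le> mean_vol m"
proof -
  \<comment> \<open>The inscribed ball keeps the support function of its centre at least
    \<open>\<rho>\<close> below that of the body in every unit direction.\<close>
  have inner: "u \<bullet> c + \<rho> \<le> mean_support u" if u: "norm u = 1" for u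
  proof -
    have "c + \<rho> *\<^sub>R u \<in> body 0" using \<rho> u by (intro subsetD[OF \<rho>(2)]) (simp add: dist_norm)
    then have "u \<bullet> (c + \<rho> *\<^sub>R u) \<le> mean_support u" using u by (auto simp: body_def)
    then show ?thesis using u by (simp add: inner_add_right dot_square_norm)
  qed
  have "expectation (\<lambda>w. (1 - deviation U \<eta> m w / \<rho>) * vol_radius (body 0)) \<le> mean_vol m"
    unfolding mean_vol_def
  proof (rule integral_mono_AE)
    show "AE w in P. (1 - deviation U \<eta> m w / \<rho>) * vol_radius (body 0) \<le> vol_radius (minkowski_mean (\<lambda>i. K i w) m)"
      using AE_convex_body AE_support_deviation[OF U(1,2) m]
    proof eventually_elim
      case (elim w)
      let ?M = "minkowski_mean (\<lambda>i. K i w) m"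
      \<comment> \<open>With this choice \<open>t * \<rho>\<close> equals the deviation: contracting
        the body towards \<open>c\<close> by the factor \<open>1 - t\<close> lowers its support
        function by at least the possible error.\<close>
      define t where "t = deviation U \<eta> m w / \<rho>"
      have t: "0 \<le> t" using deviation_nonneg[OF U(3)] \<rho> by (simp add: t_def)
      have M: "compact ?M" "convex ?M"
        using elim(1) by (auto intro!: minkowski_mean_compact_convex)
      show ?case
      proof (cases "t \<le> 1")
        case True
        have "(\<lambda>x. (1 - t) *\<^sub>R x + t *\<^sub>R c) ` body 0 \<subseteq> ?M"
        proof (rule image_subsetI)
          fix y assume y: "y \<in> body 0"
          show "(1 - t) *\<^sub>R y + t *\<^sub>R c \<in> ?M"
          proof (rule convex_mem_of_support_le[OF M(2) compact_imp_closed[OF M(1)]])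
            show "?M \<noteq> {}"
              using minkowski_mean_support_attained[of m "\<lambda>i. K i w" 0] elim(1) by auto
            fix u :: 'a assume u: "norm u = 1"
            obtain x where x: "x \<in> ?M" "u \<bullet> x = (\<Sum>i=1..m. support_fun u (K i w)) / real m"
              using minkowski_mean_support_attained[of m "\<lambda>i. K i w" u] elim(1) by auto
            have "u \<bullet> ((1 - t) *\<^sub>R y + t *\<^sub>R c) = (1 - t) * (u \<bullet> y) + t * (u \<bullet> c)"
              by (simp add: inner_add_right)
            also have "\<dots> \<le> (1 - t) * mean_support u + t * (mean_support u - \<rho>)"
              using y u inner[OF u] True t by (intro add_mono mult_left_mono) (auto simp: body_def)
            also have "\<dots> = mean_support u - deviation U \<eta> m w"
              using \<rho> by (simp add: t_def field_simps)
            also have "\<dots> \<le> u \<bullet> x" using elim(2)[rule_format, OF u] unfolding x(2) abs_le_iff by linarith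
            finally show "\<exists>x\<in>?M. u \<bullet> ((1 - t) *\<^sub>R y + t *\<^sub>R c) \<le> u \<bullet> x" using x(1) by blast
          qed
        qed
        moreover have "(\<lambda>x. (1 - t) *\<^sub>R x + t *\<^sub>R c) ` body 0 \<in> sets lebesgue"
          by (intro fmeasurableD lmeasurable_compact compact_continuous_image continuous_intros compact_body) simp
        ultimately have "vol_radius ((\<lambda>x. (1 - t) *\<^sub>R x + t *\<^sub>R c) ` body 0) \<le> vol_radius ?M"
          using M by (intro vol_radius_mono lmeasurable_compact)
        then show ?thesis using True by (simp add: vol_radius_affine t_def)
      next
        case False
        then have "(1 - t) * vol_radius (body 0) \<le> 0"
          using vol_radius_nonneg by (intro mult_nonpos_nonneg) auto
        then show ?thesis using vol_radius_nonneg[of ?M] by (simp add: t_def)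
      qed
    qed
  qed (use integrable_vol_radius_mean integrable_deviation in auto)
  then show ?thesis using integrable_deviation by (simp add: prob_space)
qed

lemma mean_vol_tendsto: "mean_vol \<longlonglongrightarrow> vol_radius (body 0)"
proof -
  have dev: "\<exists>U \<eta>. finite U \<and> (\<forall>u::'a. norm u = 1 \<longrightarrow> (\<exists>v\<in>U. norm (u - v) \<le> \<eta>)) \<and> 0 \<le> \<eta> \<and>
      (\<forall>\<^sub>F m in sequentially. expectation (deviation U \<eta> m) < e)" if e: "0 < e" for e
  proof -
    \<comment> \<open>The limit \<open>\<eta> * (2 * mean_radius)\<close> then stays below
      \<open>e\<close>; the added 1 keeps the denominator positive when \<open>mean_radius\<close>
      is 0.\<close>
    define \<eta> where "\<eta> = e / (2 * mean_radius + 1) / 2"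
    have \<eta>: "0 < \<eta>" using e mean_radius_nonneg by (simp add: \<eta>_def)
    obtain U :: "'a set" where U: "finite U" "\<forall>u. norm u = 1 \<longrightarrow> (\<exists>v\<in>U. norm (u - v) \<le> \<eta>)"
      using sphere_finite_net[OF \<eta>] by blast
    have "\<eta> * (2 * mean_radius) < e"
      using e mean_radius_nonneg by (simp add: \<eta>_def divide_simps)
    then have "\<forall>\<^sub>F m in sequentially. expectation (deviation U \<eta> m) < e"
      using expectation_deviation_tendsto by (intro order_tendstoD(2))
    then show ?thesis using U \<eta> by (intro exI[of _ U] exI[of _ \<eta>]) auto
  qed
  show ?thesis
  proof (rule order_tendstoI)
    fix a assume a: "vol_radius (body 0) < a"
    obtain k where k: "vol_radius (body (1 / real (Suc k))) < a"
      using order_tendstoD(2)[OF vol_radius_body_tendsto a] by (auto simp: eventually_sequentially)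
    define \<delta> where "\<delta> = 1 / real (Suc k)"
    define C where "C = (mean_radius / \<delta> + 1) * vol_radius (cball (0::'a) 1)"
    have C: "0 \<le> C" unfolding C_def \<delta>_def using mean_radius_nonneg
      by (intro mult_nonneg_nonneg vol_radius_nonneg add_nonneg_nonneg) auto
    \<comment> \<open>Dividing by \<open>C + 1\<close> covers \<open>C = 0\<close> and leaves
      \<open>C\<close> times this tolerance strictly below the gap.\<close>
    have e: "0 < (a - vol_radius (body \<delta>)) / (C + 1)" using k C by (simp add: \<delta>_def)
    obtain U \<eta> where U: "finite U" "\<forall>u::'a. norm u = 1 \<longrightarrow> (\<exists>v\<in>U. norm (u - v) \<le> \<eta>)" "0 \<le> \<eta>"
      and ev: "\<forall>\<^sub>F m in sequentially. expectation (deviation U \<eta> m) < (a - vol_radius (body \<delta>)) / (C + 1)"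
      using dev[OF e] by blast
    from ev eventually_ge_at_top[of 1] show "\<forall>\<^sub>F m in sequentially. mean_vol m < a"
    proof eventually_elim
      case (elim m)
      have "C * expectation (deviation U \<eta> m) \<le> C * ((a - vol_radius (body \<delta>)) / (C + 1))"
        using elim(1) C by (intro mult_left_mono) auto
      also have "\<dots> < a - vol_radius (body \<delta>)"
        using k C by (simp add: \<delta>_def field_simps)
      finally show ?case
        using mean_vol_upper[OF U elim(2), of \<delta>] by (simp add: C_def \<delta>_def)
    qed
  next
    fix a assume a: "a < vol_radius (body 0)"
    show "\<forall>\<^sub>F m in sequentially. a < mean_vol m"
    \<comment> \<open>A limit body of volume zero occurs only in the first case. A nonnegative
      \<open>a\<close> below the limit forces positive volume, and a convex set that is not null has
      interior points.\<close>
    proof (cases "a < 0")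
      case True
      have "0 \<le> mean_vol m" for m
        unfolding mean_vol_def by (intro integral_nonneg_AE) (simp add: vol_radius_nonneg)
      then show ?thesis using True by (auto intro: always_eventually less_le_trans)
    next
      case False
      then have pos: "0 < vol_radius (body 0)" using a by simp
      then have "measure lebesgue (body 0) \<noteq> 0" by (auto simp: vol_radius_def)
      then have "\<not> negligible (body 0)" using negligible_imp_measure0 by blast
      then have "interior (body 0) \<noteq> {}"
        using negligible_convex_interior[OF convex_body_set] by blast
      then obtain c \<rho> where \<rho>: "0 < \<rho>" "cball c \<rho> \<subseteq> body 0"
        using mem_interior_cball by blast
      have e: "0 < \<rho> * (1 - a / vol_radius (body 0))" using \<rho> a pos by simp
      obtain U \<eta> where U: "finite U" "\<forall>u::'a. norm u = 1 \<longrightarrow> (\<exists>v\<in>U. norm (u - v) \<le> \<eta>)" "0 \<le> \<eta>"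
        and ev: "\<forall>\<^sub>F m in sequentially. expectation (deviation U \<eta> m) < \<rho> * (1 - a / vol_radius (body 0))"
        using dev[OF e] by blast
      from ev eventually_ge_at_top[of 1] show ?thesis
      proof eventually_elim
        case (elim m)
        have "expectation (deviation U \<eta> m) / \<rho> < 1 - a / vol_radius (body 0)"
          using elim(1) \<rho> by (simp add: field_simps)
        then have "a / vol_radius (body 0) < 1 - expectation (deviation U \<eta> m) / \<rho>" by simp
        then have "a < (1 - expectation (deviation U \<eta> m) / \<rho>) * vol_radius (body 0)"
          using pos by (simp add: pos_divide_less_eq)
        also have "\<dots> \<le> mean_vol m" by (rule mean_vol_lower[OF U elim(2) \<rho>])
        finally show ?case .
      qed
    qed
  qed
qed

end

section \<open>The volume of the Aumann expectation\<close>

text \<open>This reduces the measurability of nearest-point selections to countably many hitting events.\<close>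

lemma closest_point_mem_iff:
  fixes S C :: "'a::euclidean_space set"
  assumes S: "closed S" "convex S" "S \<noteq> {}" and C: "closed C"
  shows "closest_point S p \<in> C \<longleftrightarrow>
    (\<forall>q\<in>\<rat>. S \<inter> cball p q \<noteq> {} \<longrightarrow> S \<inter> (C \<inter> cball p q) \<noteq> {})" (is "_ \<longleftrightarrow> ?R")
proof
  have cp: "closest_point S p \<in> S" using closest_point_in_set[OF S(1,3)] .
  {
    assume c: "closest_point S p \<in> C"
    show ?R
    proof (intro ballI impI)
      fix q :: real assume "S \<inter> cball p q \<noteq> {}"
      then obtain y where "y \<in> S" "dist p y \<le> q" by auto
      then have "dist p (closest_point S p) \<le> q"
        using closest_point_le[OF S(1), of y p] by simp
      then show "S \<inter> (C \<inter> cball p q) \<noteq> {}" using cp c by auto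
    qed
  next
    assume R: ?R
    have hit: "S \<inter> (C \<inter> cball p q) \<noteq> {}" if "q \<in> \<rat>" "dist p (closest_point S p) \<le> q" for q
    proof -
      have "S \<inter> cball p q \<noteq> {}" using cp that(2) by auto
      then show ?thesis using R that(1) by blast
    qed
    \<comment> \<open>Any rational radius that reaches \<open>S\<close> serves here; it only shows
      that \<open>S\<close> meets \<open>C\<close>, so that a nearest point of the intersection
      exists.\<close>
    obtain q0 :: real where "q0 \<in> \<rat>" "dist p (closest_point S p) < q0"
      using Rats_dense_in_real[of _ "dist p (closest_point S p) + 1"] by (metis less_add_one)
    then have ne: "S \<inter> C \<noteq> {}" using hit[of q0] by auto
    \<comment> \<open>If \<open>y\<close> were farther from \<open>p\<close> than the nearest point
      of \<open>S\<close>, a rational radius strictly in between would be reached by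
      \<open>S\<close> but not by \<open>S \<inter> C\<close>. Uniqueness of nearest points in
      convex sets then identifies the two.\<close>
    define y where "y = closest_point (S \<inter> C) p"
    have y: "y \<in> S" "y \<in> C"
      using closest_point_in_set[OF closed_Int[OF S(1) C] ne] by (auto simp: y_def)
    have "dist p y \<le> dist p (closest_point S p)"
    proof (rule ccontr)
      assume "\<not> ?thesis"
      then obtain q where q: "q \<in> \<rat>" "dist p (closest_point S p) < q" "q < dist p y"
        using Rats_dense_in_real[of "dist p (closest_point S p)" "dist p y"] by auto
      then have "S \<inter> (C \<inter> cball p q) \<noteq> {}" by (intro hit) auto
      then obtain z where "z \<in> S \<inter> (C \<inter> cball p q)" by blast
      then have "dist p y \<le> q"
        unfolding y_def using closest_point_le[OF closed_Int[OF S(1) C], of z p] by simp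
      then show False using q(3) by simp
    qed
    then have "y = closest_point S p"
      using closest_point_le[OF S(1), of _ p] by (intro closest_point_unique[OF S(2,1) y(1)]) (meson order_trans)
    then show "closest_point S p \<in> C" using y(2) by simp
  }
qed

text \<open>With \<open>t \<rightarrow> \<infinity>\<close> nearest points serve as selections that almost attain the support function, so
  no general measurable selection theorem is needed.\<close>

lemma closest_point_support:
  fixes F :: "'a::euclidean_space set"
  assumes F: "compact F" "F \<noteq> {}" "F \<subseteq> cball 0 r" and t: "0 < t"
  shows "support_fun u F - r\<^sup>2 / (2 * t) \<le> u \<bullet> closest_point F (t *\<^sub>R u)"
    and "u \<bullet> closest_point F (t *\<^sub>R u) \<le> support_fun u F"
proof -
  define x where "x = closest_point F (t *\<^sub>R u)"
  have x: "x \<in> F" unfolding x_def using F by (intro closest_point_in_set compact_imp_closed)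
  then show "u \<bullet> closest_point F (t *\<^sub>R u) \<le> support_fun u F"
    unfolding x_def by (rule support_fun_upper[OF F(1)])
  obtain y where y: "y \<in> F" "u \<bullet> y = support_fun u F" using support_fun_attained[OF F(1,2)] by blast
  have "dist (t *\<^sub>R u) x \<le> dist (t *\<^sub>R u) y"
    unfolding x_def using F(1) y(1) by (intro closest_point_le compact_imp_closed)
  then have "(norm (t *\<^sub>R u - x))\<^sup>2 \<le> (norm (t *\<^sub>R u - y))\<^sup>2"
    by (simp add: dist_norm)
  \<comment> \<open>Expanding the squares cancels \<open>t^2\<close> times the squared norm of
    \<open>u\<close>. The linear part carries the factor \<open>2 * t\<close>, against which the
    quadratic terms, bounded by \<open>r^2\<close>, become negligible.\<close>
  then have "x \<bullet> x - 2 * t * (u \<bullet> x) \<le> y \<bullet> y - 2 * t * (u \<bullet> y)"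
    by (simp add: power2_norm_eq_inner inner_diff_left inner_diff_right inner_commute)
  moreover have "y \<bullet> y \<le> r\<^sup>2"
  proof -
    have "norm y \<le> r" using y(1) F(3) by auto
    then have "(norm y)\<^sup>2 \<le> r\<^sup>2" by (intro power_mono) auto
    then show ?thesis by (simp add: power2_norm_eq_inner)
  qed
  moreover have "0 \<le> x \<bullet> x" by simp
  ultimately have "2 * t * (u \<bullet> y) - 2 * t * (u \<bullet> x) \<le> r\<^sup>2" by linarith
  then have "u \<bullet> y - u \<bullet> x \<le> r\<^sup>2 / (2 * t)" using t by (simp add: field_simps)
  then show "support_fun u F - r\<^sup>2 / (2 * t) \<le> u \<bullet> closest_point F (t *\<^sub>R u)"
    by (simp add: y(2)[symmetric] x_def[symmetric])
qed

section \<open>Selections and the closure of the Aumann expectation\<close>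

context iid_convex_sets
begin

abbreviation aumann_body :: "'a set" where
  "aumann_body \<equiv> aumann_expectation P (K 0)"

lemma selector_integrable:
  assumes "selector P (K 0) \<xi>"
  shows "integrable P \<xi>"
proof (rule Bochner_Integration.integrable_bound[OF integrable_radius[of 0]])
  show "\<xi> \<in> borel_measurable P" using assms by (simp add: selector_def)
  have "AE w in P. \<xi> w \<in> K 0 w" using assms by (simp add: selector_def)
  then show "AE w in P. norm (\<xi> w) \<le> norm (radius 0 w)"
    using AE_subset_cball_radius
  proof eventually_elim
    case (elim w)
    then have "\<xi> w \<in> cball 0 (radius 0 w)" by blast
    then show ?case by simp
  qed
qed

lemma aumann_body_subset: "aumann_body \<subseteq> body 0"
proof
  fix a assume "a \<in> aumann_body"
  then obtain \<xi> where \<xi>: "selector P (K 0) \<xi>" "a = expectation \<xi>"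
    by (auto simp: aumann_expectation_def)
  note int = selector_integrable[OF \<xi>(1)]
  have "u \<bullet> a \<le> mean_support u" for u
  proof -
    have "u \<bullet> a = expectation (\<lambda>w. u \<bullet> \<xi> w)"
      using int by (simp add: \<xi>(2))
    also have "\<dots> \<le> mean_support u"
      unfolding mean_support_def
    proof (rule integral_mono_AE)
      have "AE w in P. \<xi> w \<in> K 0 w" using \<xi>(1) by (simp add: selector_def)
      then show "AE w in P. u \<bullet> \<xi> w \<le> support_fun u (K 0 w)"
        using AE_convex_body by eventually_elim (simp add: support_fun_upper)
    qed (use int integrable_support in auto)
    finally show ?thesis .
  qed
  then show "a \<in> body 0" by (simp add: body_def)
qed

text \<open>The realizations are almost surely convex, so pointwise convex combinations of
  selections are again selections.\<close>

lemma convex_aumann_body: "convex aumann_body"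
proof (rule convexI)
  fix a b :: 'a and u v :: real
  assume "a \<in> aumann_body" "b \<in> aumann_body" and uv: "0 \<le> u" "0 \<le> v" "u + v = 1"
  then obtain \<xi> \<zeta> where \<xi>: "selector P (K 0) \<xi>" "a = expectation \<xi>" and \<zeta>: "selector P (K 0) \<zeta>" "b = expectation \<zeta>"
    by (auto simp: aumann_expectation_def)
  let ?\<psi> = "\<lambda>w. u *\<^sub>R \<xi> w + v *\<^sub>R \<zeta> w"
  have "AE w in P. \<xi> w \<in> K 0 w" "AE w in P. \<zeta> w \<in> K 0 w"
    using \<xi>(1) \<zeta>(1) by (simp_all add: selector_def)
  then have "AE w in P. ?\<psi> w \<in> K 0 w"
    using AE_convex_body by eventually_elim (auto intro: convexD uv)
  moreover have "?\<psi> \<in> borel_measurable P"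
    using \<xi>(1) \<zeta>(1) unfolding selector_def
    by (intro borel_measurable_add borel_measurable_scaleR borel_measurable_const) auto
  ultimately have sel: "selector P (K 0) ?\<psi>" by (simp add: selector_def)
  have "u *\<^sub>R a + v *\<^sub>R b = expectation ?\<psi>"
    using selector_integrable[OF \<xi>(1)] selector_integrable[OF \<zeta>(1)] by (simp add: \<xi>(2) \<zeta>(2))
  then show "u *\<^sub>R a + v *\<^sub>R b \<in> aumann_body"
    using sel selector_integrable[OF sel] by (auto simp: aumann_expectation_def)
qed

lemma closest_point_selector:
  "\<exists>\<xi>. selector P (K 0) \<xi> \<and> (AE w in P. \<xi> w = closest_point (K 0 w) p)"
proof -
  \<comment> \<open>\<open>N\<close> is a measurable null set around the exceptional points. Setting
    the selection to 0 on \<open>N\<close> makes it measurable on the whole space without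
    completeness of \<open>P\<close>.\<close>
  obtain N where N: "{w \<in> space P. \<not> (\<forall>i. compact (K i w) \<and> convex (K i w) \<and> K i w \<noteq> {})} \<subseteq> N"
    "emeasure P N = 0" "N \<in> sets P"
    using AE_E[OF AE_convex_body] by blast
  have good: "compact (K 0 w)" "convex (K 0 w)" "K 0 w \<noteq> {}" if "w \<in> space P - N" for w
    using N(1) that by blast+
  define \<xi> where "\<xi> w = (if w \<in> N then 0 else closest_point (K 0 w) p)" for w
  have AE_N: "AE w in P. w \<notin> N" using N(2,3) by (intro AE_not_in) auto
  have eq: "AE w in P. \<xi> w = closest_point (K 0 w) p"
    using AE_N by eventually_elim (simp add: \<xi>_def)
  have closed: "\<xi> -` C \<inter> space P \<in> sets P" if C: "closed C" for C
  proof -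
    have hit: "{w \<in> space P. K 0 w \<inter> D \<noteq> {}} \<in> sets P" if "compact D" for D
      using hits_compacts_measurablyD[OF hits_compacts_measurably_closed_sets[OF K_measurable] that] .
    have "{w \<in> space P. \<forall>q\<in>\<rat>. K 0 w \<inter> cball p q \<noteq> {} \<longrightarrow> K 0 w \<inter> (C \<inter> cball p q) \<noteq> {}} \<in> sets P" (is "?A \<in> _")
    proof (intro sets.sets_Collect_countable_All' sets.sets_Collect_imp hit)
      show "compact (C \<inter> cball p q)" for q using C by (simp add: closed_Int_compact)
    qed (auto intro: countable_rat)
    then have "(?A - N) \<union> (if 0 \<in> C then N else {}) \<in> sets P" using N(3) by auto
    moreover have "\<xi> -` C \<inter> space P = (?A - N) \<union> (if 0 \<in> C then N else {})"
    proof -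
      have "w \<in> \<xi> -` C \<longleftrightarrow> w \<in> ?A" if w: "w \<in> space P - N" for w
        using closest_point_mem_iff[OF compact_imp_closed[OF good(1)[OF w]] good(2,3)[OF w] C, of p] w
        by (simp add: \<xi>_def)
      moreover have "w \<in> \<xi> -` C \<longleftrightarrow> 0 \<in> C" if "w \<in> N" for w
        using that by (simp add: \<xi>_def)
      moreover have "N \<subseteq> space P" "?A \<subseteq> space P" using N(3) sets.sets_into_space by auto
      ultimately show ?thesis by (auto split: if_splits)
    qed
    ultimately show ?thesis by simp
  qed
  have "\<xi> \<in> borel_measurable P"
  proof (rule borel_measurableI)
    fix S :: "'a set" assume "open S"
    then have "space P - (\<xi> -` (- S) \<inter> space P) \<in> sets P"
      by (intro sets.compl_sets closed) (simp add: closed_Compl)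
    also have "space P - (\<xi> -` (- S) \<inter> space P) = \<xi> -` S \<inter> space P" by auto
    finally show "\<xi> -` S \<inter> space P \<in> sets P" .
  qed
  moreover have "AE w in P. \<xi> w \<in> K 0 w"
    using eq AE_convex_body
    by eventually_elim (simp add: closest_point_in_set compact_imp_closed)
  ultimately show ?thesis using eq by (auto simp: selector_def)
qed

text \<open>Nearest points to \<open>(k + 1) u\<close> miss the support value by at most
  \<open>(radius 0 w)^2 / (2 * (k + 1))\<close>. The squared radius need not be integrable, so the
  limit is taken by dominated convergence with \<open>norm u * radius 0 w\<close> instead of
  integrating the error.\<close>

lemma aumann_body_support_tendsto:
  "\<exists>a. (\<forall>k. a k \<in> aumann_body) \<and> (\<lambda>k. u \<bullet> a k) \<longlonglongrightarrow> mean_support u"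
proof -
  have "\<forall>k. \<exists>\<xi>. selector P (K 0) \<xi> \<and> (AE w in P. \<xi> w = closest_point (K 0 w) (real (Suc k) *\<^sub>R u))"
    using closest_point_selector by blast
  then obtain \<xi> where \<xi>: "\<And>k. selector P (K 0) (\<xi> k)"
    "\<And>k. AE w in P. \<xi> k w = closest_point (K 0 w) (real (Suc k) *\<^sub>R u)"
    by metis
  note int = selector_integrable[OF \<xi>(1)]
  have "AE w in P. \<forall>k. \<xi> k w = closest_point (K 0 w) (real (Suc k) *\<^sub>R u)"
    unfolding AE_all_countable using \<xi>(2) by blast
  then have near: "AE w in P. \<forall>k. support_fun u (K 0 w) - (radius 0 w)\<^sup>2 / (2 * real (Suc k)) \<le> u \<bullet> \<xi> k w
      \<and> u \<bullet> \<xi> k w \<le> support_fun u (K 0 w)"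
    using AE_convex_body AE_subset_cball_radius
  proof eventually_elim
    case (elim w)
    then have K: "compact (K 0 w)" "K 0 w \<noteq> {}" "K 0 w \<subseteq> cball 0 (radius 0 w)"
      by auto
    show ?case
    proof
      fix k
      show "support_fun u (K 0 w) - (radius 0 w)\<^sup>2 / (2 * real (Suc k)) \<le> u \<bullet> \<xi> k w
          \<and> u \<bullet> \<xi> k w \<le> support_fun u (K 0 w)"
        using closest_point_support[OF K, of "real (Suc k)" u] elim(1) by (simp del: of_nat_Suc)
    qed
  qed
  have "(\<lambda>k. expectation (\<lambda>w. u \<bullet> \<xi> k w)) \<longlonglongrightarrow> mean_support u"
    unfolding mean_support_def
  proof (rule integral_dominated_convergence)
    show "integrable P (\<lambda>w. norm u * radius 0 w)" using integrable_radius by simp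
    show "AE w in P. (\<lambda>k. u \<bullet> \<xi> k w) \<longlonglongrightarrow> support_fun u (K 0 w)"
      using near
    proof eventually_elim
      case (elim w)
      have "(\<lambda>k. support_fun u (K 0 w) - (radius 0 w)\<^sup>2 / 2 * (1 / real (Suc k))) \<longlonglongrightarrow> support_fun u (K 0 w) - (radius 0 w)\<^sup>2 / 2 * 0"
        using LIMSEQ_inverse_real_of_nat by (intro tendsto_intros) (simp add: inverse_eq_divide)
      then have "(\<lambda>k. support_fun u (K 0 w) - (radius 0 w)\<^sup>2 / (2 * real (Suc k))) \<longlonglongrightarrow> support_fun u (K 0 w)"
        by simp
      then show ?case
        by (rule tendsto_sandwich[OF _ _ _ tendsto_const, rotated 2]) (use elim in auto)
    qed
    show "AE w in P. norm (u \<bullet> \<xi> k w) \<le> norm u * radius 0 w" for k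
    proof -
      have "AE w in P. \<xi> k w \<in> K 0 w" using \<xi>(1) by (simp add: selector_def)
      then show ?thesis using AE_subset_cball_radius
      proof eventually_elim
        case (elim w)
        then have "\<xi> k w \<in> cball 0 (radius 0 w)" by blast
        then have "norm u * norm (\<xi> k w) \<le> norm u * radius 0 w"
          by (intro mult_left_mono) auto
        then show ?case using Cauchy_Schwarz_ineq2[of u "\<xi> k w"] by simp
      qed
    qed
  qed (use int support_random_measurable in auto)
  moreover have "expectation (\<lambda>w. u \<bullet> \<xi> k w) = u \<bullet> expectation (\<xi> k)" for k
    using int by simp
  moreover have "expectation (\<xi> k) \<in> aumann_body" for k
    using \<xi>(1) int by (auto simp: aumann_expectation_def)
  ultimately show ?thesis by (intro exI[of _ "\<lambda>k. expectation (\<xi> k)"]) auto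
qed

text \<open>The Aumann expectation lies in \<open>body 0\<close> and approaches its support value in
  every direction, so its closure is \<open>body 0\<close>. A convex set has a null frontier, hence
  passing to the closure does not change the volume.\<close>

lemma vol_radius_aumann_body: "vol_radius aumann_body = vol_radius (body 0)"
proof -
  have ne: "aumann_body \<noteq> {}" using aumann_body_support_tendsto[of 0] by auto
  have "body 0 \<subseteq> closure aumann_body"
  proof
    fix y assume y: "y \<in> body 0"
    show "y \<in> closure aumann_body"
    proof (rule convex_mem_of_support_le)
      show "convex (closure aumann_body)" "closed (closure aumann_body)" "closure aumann_body \<noteq> {}"
        using ne by (simp_all add: convex_closure convex_aumann_body)
      fix u :: 'a assume u: "norm u = 1"
      have comp: "compact (closure aumann_body)"
        using closure_minimal[OF aumann_body_subset closed_body] compact_body[of 0]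
        by (metis closed_closure compact_Int_closed inf.absorb2 order_refl)
      obtain a where a: "\<And>k. a k \<in> aumann_body" "(\<lambda>k. u \<bullet> a k) \<longlonglongrightarrow> mean_support u"
        using aumann_body_support_tendsto by blast
      obtain x where x: "x \<in> closure aumann_body" "\<And>z. z \<in> closure aumann_body \<Longrightarrow> u \<bullet> z \<le> u \<bullet> x"
        using support_fun_attained[OF comp, of u] ne by (metis closure_eq_empty)
      have "mean_support u \<le> u \<bullet> x"
        using a(1) closure_subset by (intro LIMSEQ_le_const2[OF a(2)]) (auto intro!: x(2))
      moreover have "u \<bullet> y \<le> mean_support u" using y u by (auto simp: body_def)
      ultimately show "\<exists>x\<in>closure aumann_body. u \<bullet> y \<le> u \<bullet> x" using x(1) by (blast intro: order_trans)
    qed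
  qed
  then have "closure aumann_body = body 0"
    using closure_minimal[OF aumann_body_subset closed_body] by blast
  moreover have "measure lebesgue (closure aumann_body) = measure lebesgue aumann_body"
  proof (rule measure_closure)
    show "bounded aumann_body"
      using aumann_body_subset compact_body[of 0] bounded_subset compact_imp_bounded by auto
    show "negligible (frontier aumann_body)" by (rule negligible_convex_frontier[OF convex_aumann_body])
  qed
  ultimately show ?thesis by (simp add: vol_radius_def)
qed

end

theorem theorem4p5:
  fixes P :: "'w measure"
    and K :: "nat \<Rightarrow> 'w \<Rightarrow> (real ^ 'n) set"
  assumes "prob_space P"
    and "\<And>i. random_compact_convex_set P (K i)"
    and "\<And>i. AE w in P. K i w \<noteq> {}"
    and "prob_space.indep_vars P (\<lambda>_. closed_sets_borel) K UNIV"
    and "\<And>i. distr P closed_sets_borel (K i) = distr P closed_sets_borel (K 0)"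
    and "(\<integral>\<^sup>+ w. set_norm (K 0 w) \<partial>P) < \<infinity>"
  shows "(\<forall>m\<ge>1. integrable P
            (\<lambda>w. measure lebesgue (minkowski_mean (\<lambda>i. K i w) m) powr (1 / real CARD('n))))
       \<and> mono_on {1..} (\<lambda>m. prob_space.expectation P
            (\<lambda>w. measure lebesgue (minkowski_mean (\<lambda>i. K i w) m) powr (1 / real CARD('n))))
       \<and> (\<lambda>m. prob_space.expectation P
            (\<lambda>w. measure lebesgue (minkowski_mean (\<lambda>i. K i w) m) powr (1 / real CARD('n))))
          \<longlonglongrightarrow> measure lebesgue (aumann_expectation P (K 0)) powr (1 / real CARD('n))"
proof -
  interpret iid_convex_sets P K
    using assms by (intro iid_convex_sets.intro iid_convex_sets_axioms.intro)
  have vol: "measure lebesgue S powr (1 / real CARD('n)) = vol_radius S" for S :: "(real ^ 'n) set"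
    by (simp add: vol_radius_def)
  show ?thesis
    unfolding vol mean_vol_def[symmetric] vol_radius_aumann_body
    using integrable_vol_radius_mean mean_vol_mono mean_vol_tendsto by simp
qed

end
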